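(* Let $n\ge 1$ and let $\mathbf{p}=(\mathbf{p}_1,\dots,\mathbf{p}_N)$ and $\mathbf{q}=(\mathbf{q}_1,\dots,\mathbf{q}_N)$ be configurations of $N$ points in $\mathbb{E}^n$ such that $|\mathbf{p}_i-\mathbf{p}_j|\le|\mathbf{q}_i-\mathbf{q}_j|$ for all $1\le i<j\le N$. Then there exists $r_0>0$ such that for every $r\ge r_0$ $$\mathrm{Vol}_n\Big[\bigcup_{i=1}^N B_n(\mathbf{p}_i,r)\Big]\le \mathrm{Vol}_n\Big[\bigcup_{i=1}^N B_n(\mathbf{q}_i,r)\Big]\quad\text{and}\quad \mathrm{Vol}_n\Big[\bigcap_{i=1}^N B_n(\mathbf{p}_i,r)\Big]\ge \mathrm{Vol}_n\Big[\bigcap_{i=1}^N B_n(\mathbf{q}_i,r)\Big].$$ Moreover, if $\mathbf{p}$ and $\mathbf{q}$ are not congruent (i.e. there is no isometry of $\mathbb{E}^n$ mapping $\mathbf{p}_i$ to $\mathbf{q}_i$ for all $i$), then both inequalities are strict for every $r\ge r_0$.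
   Context: $|\cdot|$ is the Euclidean norm, $B_n(\mathbf{x},r)$ denotes the closed $n$-dimensional ball of radius $r$ centered at $\mathbf{x}\in\mathbb{E}^n$, and $\mathrm{Vol}_n$ is $n$-dimensional volume (Lebesgue measure). *)

theory Defs
  imports "HOL-Analysis.Analysis"
begin

definition congruent_config :: "nat \<Rightarrow> (nat \<Rightarrow> 'a::metric_space) \<Rightarrow> (nat \<Rightarrow> 'a) \<Rightarrow> bool" where
  "congruent_config N p q \<longleftrightarrow>
     (\<exists>f::'a \<Rightarrow> 'a. (\<forall>x y. dist (f x) (f y) = dist x y) \<and> (\<forall>i<N. f (p i) = q i))"

end

theory Submission
  imports Defs
begin

text \<open>
  Both volumes are integrals over directions of powers of radial functions, and as \<open>r\<close> grows the radial
  function of the union is \<open>r + h\<^sub>p(u) + O(1/r)\<close>, where \<open>h\<^sub>p(u) = max\<^sub>i p\<^sub>i \<bullet> u\<close>; for the intersection it is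
  \<open>r - h\<^sub>p(- u) + O(1/r)\<close>. So it suffices to show that the mean width strictly increases:
  \<open>\<integral> h\<^sub>p < \<integral> h\<^sub>q\<close> unless all distances agree, in which case \<open>p\<close> and \<open>q\<close> are congruent.

  For this one moves \<open>p\<close> to \<open>q\<close> along \<open>(cos t p\<^sub>i, sin t q\<^sub>i)\<close> in the doubled space. Replacing the maximum by
  \<open>ln (\<Sum>\<^sub>i exp (\<beta> \<dots>)) / \<beta>\<close> and integrating by parts against a rotation invariant weight, the
  derivative becomes a positive combination of the numbers \<open>|q\<^sub>i - q\<^sub>j|\<^sup>2 - |p\<^sub>i - p\<^sub>j|\<^sup>2\<close>. The
  coefficient of a pair stays away from \<open>0\<close> as \<open>\<beta> \<rightarrow> \<infinity>\<close> if the pair spans an edge of the convex hull of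
  the points \<open>(p\<^sub>i, q\<^sub>i)\<close>. Finally, the quadratic form \<open>|y|\<^sup>2 - |x|\<^sup>2\<close> is nonnegative on the differences of these points; if it
  vanished on all edges at a vertex, it would be nonpositive on the cone they span. Hence if it is
  positive on some difference, it is positive on some edge.
\<close>


subsection \<open>Edges on which a quadratic form is positive\<close>

text \<open>Strictness is the difficulty. Monotonicity is read off the sign of the derivative, but
  the smoothed maximum at scale \<open>\<beta>\<close> differs from \<open>\<beta>\<close> times the
  true maximum by up to \<open>ln N\<close>, so a strict gain survives only if it grows with
  \<open>\<beta>\<close>. Scaling the points by \<open>\<beta>\<close> multiplies squared distances
  by \<open>\<beta>\<^sup>2\<close>. For the ends of an edge, both softmax weights are bounded below
  where the two linear functionals agree up to \<open>1 / \<beta>\<close> and dominate the others,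
  which contains a piece of a slab of volume of order \<open>1 / \<beta>\<close>. The product is of
  order \<open>\<beta>\<close> and beats the error. One edge of the hull of the points
  \<open>(p i, q i)\<close> serves all intermediate times, because the configuration at time
  \<open>t\<close> is the image of these points under a diagonal map, invertible for
  \<open>0 < t < pi/2\<close>. Doubling the space keeps the two configurations orthogonal, so that
  every squared distance is monotone along the path. The weight is rotation invariant so that the
  two ends, which live in different factors, are measured by the same functional.\<close>

lemma extreme_point_strictly_exposed:
  fixes S :: "'a::euclidean_space set"
  assumes "finite S" "x extreme_point_of (convex hull S)"
  obtains a where "\<And>y. y \<in> S \<Longrightarrow> y \<noteq> x \<Longrightarrow> a \<bullet> y < a \<bullet> x"
proof -
  \<comment> \<open>Every face of a polyhedron is exposed, and an extreme point is a face with one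
    element.\<close>
  have "{x} exposed_face_of (convex hull S)"
    using assms by (simp add: exposed_face_of_polyhedron polyhedron_convex_hull face_of_singleton)
  then obtain a b where ab: "convex hull S \<subseteq> {x. a \<bullet> x \<le> b}" "{x} = convex hull S \<inter> {x. a \<bullet> x = b}"
    unfolding exposed_face_of_def by blast
  show ?thesis
  proof (rule that)
    fix y assume y: "y \<in> S" "y \<noteq> x"
    then have "y \<in> convex hull S" by (simp add: hull_inc)
    then have "a \<bullet> y \<le> b" "a \<bullet> y \<noteq> b" using ab y by auto
    moreover have "a \<bullet> x = b" using ab(2) by auto
    ultimately show "a \<bullet> y < a \<bullet> x" by simp
  qed
qed

lemma bilinear_polarisation:
  assumes "bilinear B" "\<And>x y. B x y = B y x"
  shows "B (x - y) (x - y) = B x x + B y y - 2 * (B x y :: real)"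
  using assms(2)[of x y] by (simp add: bilinear_lsub bilinear_rsub assms(1))

text \<open>Since all \<open>s - o'\<close> are null vectors, polarisation turns
  \<open>B (s - t) (s - t) \<ge> 0\<close> into \<open>B (s - o') (t - o') \<le> 0\<close>.
  Expanding the form at a convex combination leaves only such products with nonnegative
  coefficients. This is used twice below: for the vertices of the polytope and for those of a vertex
  figure.\<close>

lemma quadratic_form_nonpos_on_hull:
  fixes B :: "'a::euclidean_space \<Rightarrow> 'a \<Rightarrow> real"
  assumes B: "bilinear B" "\<And>x y. B x y = B y x"
    and T: "finite T" "y \<in> convex hull T"
    and null: "\<And>s. s \<in> T \<Longrightarrow> B (s - o') (s - o') = 0"
    and nonneg: "\<And>s t. s \<in> T \<Longrightarrow> t \<in> T \<Longrightarrow> B (s - t) (s - t) \<ge> 0"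
  shows "B (y - o') (y - o') \<le> 0"
proof -
  obtain u where u: "\<forall>s\<in>T. 0 \<le> u s" "sum u T = 1" "(\<Sum>s\<in>T. u s *\<^sub>R s) = y"
    using T by (auto simp: convex_hull_finite)
  have "y - o' = (\<Sum>s\<in>T. u s *\<^sub>R s) - (\<Sum>s\<in>T. u s) *\<^sub>R o'" using u by simp
  also have "\<dots> = (\<Sum>s\<in>T. u s *\<^sub>R (s - o'))"
    by (simp add: scaleR_diff_right sum_subtractf scaleR_sum_left)
  finally have eq: "y - o' = (\<Sum>s\<in>T. u s *\<^sub>R (s - o'))" .
  have le: "B (s - o') (t - o') \<le> 0" if "s \<in> T" "t \<in> T" for s t
    using nonneg[OF that] bilinear_polarisation[OF B, of "s - o'" "t - o'"] null that by simp
  have "B (y - o') (y - o') = (\<Sum>(s,t)\<in>T\<times>T. u s * (u t * B (s - o') (t - o')))"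
    unfolding eq bilinear_sum[OF B(1)]
    by (simp add: bilinear_lmul[OF B(1)] bilinear_rmul[OF B(1)] mult.left_commute)
  also have "\<dots> \<le> 0"
    using u(1) le by (intro sum_nonpos) (auto intro!: mult_nonneg_nonpos)
  finally show ?thesis .
qed

text \<open>The idea is to look at the directions of the rays from a vertex \<open>v\<close> in the slice given by
  a supporting functional (the vertex figure): if all its extreme points were null
  directions of the form, then the form would be nonpositive on every \<open>x - v\<close>.\<close>

lemma exists_positive_edge:
  fixes B :: "'a::euclidean_space \<Rightarrow> 'a \<Rightarrow> real"
  assumes B: "bilinear B" "\<And>x y. B x y = B y x"
    and S: "finite S"
    and nonneg: "\<And>x y. x \<in> S \<Longrightarrow> y \<in> S \<Longrightarrow> B (x - y) (x - y) \<ge> 0"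
    and pos: "x0 \<in> S" "y0 \<in> S" "B (x0 - y0) (x0 - y0) > 0"
  obtains v w g where "v \<in> S" "w \<in> S" "B (w - v) (w - v) > 0" "g \<bullet> w = g \<bullet> v"
    "\<And>x. x \<in> S \<Longrightarrow> x \<in> closed_segment v w \<or> g \<bullet> x < g \<bullet> v"
proof -
  define E where "E = {x. x extreme_point_of (convex hull S)}"
  have ES: "E \<subseteq> S" unfolding E_def using extreme_point_of_convex_hull by blast
  \<comment> \<open>Otherwise every vertex is null relative to \<open>y0\<close>, and
    \<open>x0\<close>, lying in the hull of the vertices, would contradict positivity of the form on
    \<open>x0 - y0\<close>.\<close>
  have "\<exists>v\<in>E. \<exists>y\<in>S. B (y - v) (y - v) > 0"
  proof (rule ccontr)
    assume "\<not> ?thesis"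
    then have z: "B (y - v) (y - v) = 0" if "v \<in> E" "y \<in> S" for y v
      using nonneg[OF that(2), of v] that ES by force
    have "x0 \<in> convex hull E"
      using Krein_Milman_polytope[OF S] pos unfolding E_def by (metis hull_inc)
    moreover have "B (s - y0) (s - y0) = 0" if "s \<in> E" for s
      using z[of s y0] that pos bilinear_polarisation[OF B, of s y0]
        bilinear_polarisation[OF B, of y0 s] B(2)[of s y0] by simp
    ultimately have "B (x0 - y0) (x0 - y0) \<le> 0"
      using finite_subset[OF ES S] nonneg subsetD[OF ES]
      by (intro quadratic_form_nonpos_on_hull[OF B]) auto
    with pos show False by simp
  qed
  then obtain v y where v: "v \<in> E" and y: "y \<in> S" "B (y - v) (y - v) > 0" by blast
  have vS: "v \<in> S" using v ES by blast
  obtain g0 where g0: "\<And>x. x \<in> S \<Longrightarrow> x \<noteq> v \<Longrightarrow> g0 \<bullet> x < g0 \<bullet> v"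
    using extreme_point_strictly_exposed[OF S] v unfolding E_def by blast
  \<comment> \<open>Depth of \<open>x\<close> below the supporting hyperplane at \<open>v\<close>.
    Dividing \<open>x - v\<close> by it moves every point into the slice where \<open>g0\<close>
    equals -1, so that equal values of \<open>f\<close> mean equal rays from
    \<open>v\<close>.\<close>
  define c where "c = (\<lambda>x. g0 \<bullet> (v - x))"
  have c: "c x > 0" if "x \<in> S - {v}" for x
    using g0[of x] that by (auto simp: c_def inner_diff_right)
  define f where "f = (\<lambda>x. (1 / c x) *\<^sub>R (x - v))"
  define Y where "Y = f ` (S - {v})"
  have cf: "x - v = c x *\<^sub>R f x" if "x \<in> S - {v}" for x
    using c[OF that] by (simp add: f_def)
  have Bf: "B (x - v) (z - v) = c x * c z * B (f x) (f z)" if "x \<in> S - {v}" "z \<in> S - {v}" for x z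
    unfolding cf[OF that(1)] cf[OF that(2)] by (simp add: bilinear_lmul[OF B(1)] bilinear_rmul[OF B(1)])
  have finY: "finite Y" using S by (simp add: Y_def)
  define F where "F = {x. x extreme_point_of (convex hull Y)}"
  have FY: "F \<subseteq> Y" unfolding F_def using extreme_point_of_convex_hull by blast
  have yv: "y \<in> S - {v}" using y by (auto simp: bilinear_lzero[OF B(1)])
  have "\<exists>e\<in>F. B e e > 0"
  proof (rule ccontr)
    assume neg: "\<not> ?thesis"
    have rep: "\<exists>x\<in>S - {v}. e = f x" if "e \<in> F" for e
      using that FY unfolding Y_def by blast
    have null: "B e e = 0" if eF: "e \<in> F" for e
    proof -
      obtain x where x: "x \<in> S - {v}" "e = f x" using rep eF by blast
      have "0 \<le> B (x - v) (x - v)" using x vS nonneg by auto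
      then have "0 \<le> B e e" unfolding Bf[OF x(1) x(1)] x(2)
        using mult_pos_pos[OF c[OF x(1)] c[OF x(1)]] zero_le_mult_iff[of "c x * c x" "B (f x) (f x)"] by linarith
      with neg eF show ?thesis by force
    qed
    have "B (f y - 0) (f y - 0) \<le> 0"
    proof (rule quadratic_form_nonpos_on_hull[OF B])
      show "finite F" using FY finY finite_subset by blast
      show "f y \<in> convex hull F"
        using Krein_Milman_polytope[OF finY] yv unfolding F_def Y_def by (metis hull_inc imageI)
      show "B (s - 0) (s - 0) = 0" if "s \<in> F" for s using null that by simp
      fix s t assume st: "s \<in> F" "t \<in> F"
      obtain x z where x: "x \<in> S - {v}" "s = f x" and z: "z \<in> S - {v}" "t = f z"
        using rep st by blast
      have "B (x - v) (x - v) = 0" "B (z - v) (z - v) = 0"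
        using Bf[OF x(1) x(1)] Bf[OF z(1) z(1)] null[OF st(1)] null[OF st(2)] x z by auto
      \<comment> \<open>The rescaling by \<open>c\<close> need not preserve the sign of the form on
        differences in general. For null rays it does, because only the mixed term survives and it
        is rescaled by a positive factor.\<close>
      then have "B (x - z) (x - z) = - 2 * (c x * c z * B s t)"
        using bilinear_polarisation[OF B, of "x - v" "z - v"] Bf[OF x(1) z(1)] x(2) z(2) by simp
      moreover have "B (x - z) (x - z) \<ge> 0" using x z nonneg by auto
      moreover have "c x * c z > 0" using c x z by simp
      ultimately have "B s t \<le> 0" by (smt (verit) mult_pos_pos)
      then show "B (s - t) (s - t) \<ge> 0"
        using bilinear_polarisation[OF B, of s t] null st by simp
    qed
    moreover have "B (f y) (f y) > 0"
      using y Bf[OF yv yv] c[OF yv] by (simp add: zero_less_mult_iff)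
    ultimately show False by simp
  qed
  then obtain e where e: "e \<in> F" "B e e > 0" by blast
  obtain a where a: "\<And>x. x \<in> Y \<Longrightarrow> x \<noteq> e \<Longrightarrow> a \<bullet> x < a \<bullet> e"
    using extreme_point_strictly_exposed[OF finY] e unfolding F_def by blast
  \<comment> \<open>Several points of \<open>S\<close> may lie on the ray of \<open>e\<close>. The
    farthest of them, \<open>w\<close>, is the other end of the edge, and the rest fall into the
    segment.\<close>
  define R where "R = {x \<in> S - {v}. f x = e}"
  have R: "finite R" "R \<noteq> {}" using S e FY by (auto simp: R_def Y_def)
  obtain w where w: "w \<in> R" "\<And>x. x \<in> R \<Longrightarrow> c x \<le> c w"
    using Max_in[of "c ` R"] R Max_ge[of "c ` R"] by (metis (no_types, lifting) finite_imageI image_iff image_is_empty)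
  have wS: "w \<in> S - {v}" "f w = e" using w by (auto simp: R_def)
  \<comment> \<open>The functional \<open>a\<close> singles out \<open>e\<close> only within the
    slice. As \<open>g0\<close> is -1 there, adding this multiple makes the functional vanish on the
    ray of \<open>e\<close> and be negative on all other rays.\<close>
  define g where "g = a + (a \<bullet> e) *\<^sub>R g0"
  have g: "g \<bullet> (x - v) = c x * (a \<bullet> f x - a \<bullet> e)" if "x \<in> S - {v}" for x
  proof -
    have "g0 \<bullet> (x - v) = - c x" by (simp add: c_def inner_diff_right)
    moreover have "a \<bullet> (x - v) = c x * (a \<bullet> f x)" by (subst cf[OF that]) simp
    ultimately show ?thesis by (simp add: g_def inner_add_left right_diff_distrib)
  qed
  show ?thesis
  proof (rule that)
    show "v \<in> S" "w \<in> S" using vS wS by auto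
    show "B (w - v) (w - v) > 0" using Bf[OF wS(1) wS(1)] wS e c[OF wS(1)] by simp
    show "g \<bullet> w = g \<bullet> v" using g[OF wS(1)] wS by (simp add: inner_diff_right)
    fix x assume x: "x \<in> S"
    show "x \<in> closed_segment v w \<or> g \<bullet> x < g \<bullet> v"
    proof (cases "x = v")
      case False
      then have xS: "x \<in> S - {v}" using x by simp
      show ?thesis
      proof (cases "f x = e")
        case True
        then have "c x \<le> c w" using w xS by (simp add: R_def)
        moreover have "x = v + (c x / c w) *\<^sub>R (w - v)"
          unfolding cf[OF wS(1)] using cf[OF xS] True wS c[OF wS(1)] by (simp add: algebra_simps)
        ultimately show ?thesis
          using c[OF xS] c[OF wS(1)] unfolding in_segment
          by (intro disjI1 exI[of _ "c x / c w"]) (simp add: algebra_simps)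
      next
        case False
        then have "a \<bullet> f x - a \<bullet> e < 0" using a[of "f x"] xS by (simp add: Y_def)
        then have "g \<bullet> (x - v) < 0" unfolding g[OF xS] using c[OF xS] by (simp add: mult_pos_neg)
        then show ?thesis by (simp add: inner_diff_right)
      qed
    qed simp
  qed
qed

text \<open>A covering argument: about \<open>1 / \<epsilon>\<close> translates of the slab piece,
  all of equal volume, cover a smaller ball, so each has volume at least a constant times
  \<open>\<epsilon>\<close>. It is applied with \<open>\<epsilon> = 1 / \<beta>\<close>, around a
  point where two linear functionals tie.\<close>

lemma measure_slab_ball_ge:
  fixes c v :: "'a::euclidean_space"
  assumes v: "v \<noteq> 0" and orth: "v \<bullet> c = 0" and \<rho>: "\<rho> > 0" and \<epsilon>: "0 < \<epsilon>" "\<epsilon> \<le> \<rho> * norm v / 4"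
  shows "\<epsilon> * measure lborel (ball (0::'a) (\<rho>/4)) \<le>
    4 * \<rho> * norm v * measure lborel (ball c \<rho> \<inter> {g. \<bar>v \<bullet> g\<bar> \<le> \<epsilon>})"
proof -
  define T where "T = ball c \<rho> \<inter> {g. \<bar>v \<bullet> g\<bar> \<le> \<epsilon>}"
  \<comment> \<open>Shifting by \<open>u\<close> changes \<open>v \<bullet> x\<close> by
    \<open>2 * \<epsilon>\<close>, the full thickness of the slab, so consecutive translates leave
    no gap.\<close>
  define u where "u = (2 * \<epsilon> / (v \<bullet> v)) *\<^sub>R v"
  have vv: "v \<bullet> v > 0" using v by simp
  have vu: "v \<bullet> u = 2 * \<epsilon>" using vv by (simp add: u_def)
  have nu: "norm u = 2 * \<epsilon> / norm v"
    using \<epsilon> v by (simp add: u_def dot_square_norm power2_eq_square)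
  define K where "K = nat \<lceil>\<rho> * norm v / (2 * \<epsilon>)\<rceil>"
  have meas[measurable]: "T \<in> sets lborel" unfolding T_def by measurable
  have img: "(+) (real_of_int j *\<^sub>R u) ` T = (\<lambda>x. x - real_of_int j *\<^sub>R u) -` T" for j
    by (force simp: image_iff algebra_simps)
  have mj: "(+) (real_of_int j *\<^sub>R u) ` T \<in> sets lborel" for j
    unfolding img using measurable_sets[of "(\<lambda>x. x - real_of_int j *\<^sub>R u)" borel borel T] meas by simp
  have ej: "measure lborel ((+) (real_of_int j *\<^sub>R u) ` T) = measure lborel T" for j
    using measure_translation[of "real_of_int j *\<^sub>R u" T] mj[of j] meas
    by (simp add: measure_completion)
  have fj: "(+) (real_of_int j *\<^sub>R u) ` T \<in> fmeasurable lborel" for j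
  proof (rule fmeasurableI[OF mj])
    have "bounded T" by (auto simp: T_def intro: bounded_subset[OF bounded_ball])
    then show "emeasure lborel ((+) (real_of_int j *\<^sub>R u) ` T) < \<infinity>"
      by (intro emeasure_bounded_finite bounded_translation)
  qed
  have "ball c (\<rho>/4) \<subseteq> (\<Union>j\<in>{- int K..int K}. (+) (real_of_int j *\<^sub>R u) ` T)"
  proof
    fix x assume x: "x \<in> ball c (\<rho>/4)"
    define j where "j = round (v \<bullet> x / (2 * \<epsilon>))"
    have j: "\<bar>v \<bullet> x - 2 * \<epsilon> * j\<bar> \<le> \<epsilon>"
    proof -
      have "\<bar>v \<bullet> x / (2 * \<epsilon>) - j\<bar> \<le> 1/2"
        unfolding j_def using of_int_round_abs_le[of "v \<bullet> x / (2 * \<epsilon>)"] by (simp add: abs_minus_commute)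
      moreover have "v \<bullet> x - 2 * \<epsilon> * j = 2 * \<epsilon> * (v \<bullet> x / (2 * \<epsilon>) - j)"
        using \<epsilon> by (simp add: field_simps)
      ultimately show ?thesis using \<epsilon> by (simp add: abs_mult)
    qed
    have vx: "\<bar>v \<bullet> x\<bar> \<le> norm v * (\<rho> / 4)"
    proof -
      have "v \<bullet> x = v \<bullet> (x - c)" using orth by (simp add: inner_diff_right)
      also have "\<bar>\<dots>\<bar> \<le> norm v * norm (x - c)" by (rule Cauchy_Schwarz_ineq2)
      also have "\<dots> \<le> norm v * (\<rho> / 4)" using x by (intro mult_left_mono) (auto simp: dist_norm norm_minus_commute)
      finally show ?thesis .
    qed
    \<comment> \<open>Equivalently, the shift by \<open>j\<close> steps has length at most
      \<open>\<rho> / 2\<close>. Together with the radius \<open>\<rho> / 4\<close> of the covered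
      ball this stays below \<open>\<rho>\<close>, which is why the smaller radius is
      chosen.\<close>
    have jb: "2 * \<epsilon> * \<bar>real_of_int j\<bar> \<le> norm v * \<rho> / 2"
    proof -
      have "2 * \<epsilon> * \<bar>real_of_int j\<bar> = \<bar>2 * \<epsilon> * j\<bar>" using \<epsilon> by (simp add: abs_mult)
      also have "\<dots> \<le> \<bar>v \<bullet> x\<bar> + \<epsilon>" using j by linarith
      also have "\<dots> \<le> norm v * \<rho> / 2" using vx \<epsilon> by (simp add: algebra_simps)
      finally show ?thesis .
    qed
    have "\<bar>real_of_int j\<bar> \<le> \<rho> * norm v / (2 * \<epsilon>)"
    proof -
      have "2 * \<epsilon> * \<bar>real_of_int j\<bar> \<le> \<rho> * norm v" using jb mult_nonneg_nonneg[OF norm_ge_zero[of v] less_imp_le[OF \<rho>]]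
        unfolding mult.commute[of \<rho>] by linarith
      then show ?thesis using \<epsilon> by (simp add: field_simps)
    qed
    then have "\<bar>j\<bar> \<le> int K" unfolding K_def by linarith
    moreover have "x - real_of_int j *\<^sub>R u \<in> T"
    proof -
      have "norm (real_of_int j *\<^sub>R u) \<le> \<rho> / 2"
        using jb v unfolding norm_scaleR nu by (simp add: field_simps)
      moreover have "norm (x - c) < \<rho> / 4" using x by (simp add: dist_norm norm_minus_commute)
      moreover have "norm (x - real_of_int j *\<^sub>R u - c) \<le> norm (x - c) + norm (real_of_int j *\<^sub>R u)"
        using norm_triangle_ineq4[of "x - c" "real_of_int j *\<^sub>R u"] by (simp add: algebra_simps)
      ultimately have "norm (x - real_of_int j *\<^sub>R u - c) < \<rho>" using \<rho> by linarith
      then show ?thesis using j by (simp add: T_def dist_norm norm_minus_commute inner_diff_right vu mult.commute)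
    qed
    ultimately show "x \<in> (\<Union>j\<in>{- int K..int K}. (+) (real_of_int j *\<^sub>R u) ` T)"
      by (intro UN_I[of j]) (auto simp: img)
  qed
  then have "measure lborel (ball c (\<rho>/4)) \<le> measure lborel (\<Union>j\<in>{- int K..int K}. (+) (real_of_int j *\<^sub>R u) ` T)"
    using mj by (intro measure_mono_fmeasurable fmeasurable.finite_UN fj) auto
  also have "\<dots> \<le> (\<Sum>j\<in>{- int K..int K}. measure lborel ((+) (real_of_int j *\<^sub>R u) ` T))"
    by (intro measure_UNION_le mj) auto
  also have "\<dots> = (2 * real K + 1) * measure lborel T" unfolding ej by simp
  finally have 1: "measure lborel (ball c (\<rho>/4)) \<le> (2 * real K + 1) * measure lborel T" .
  have "real K \<le> \<rho> * norm v / (2 * \<epsilon>) + 1"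
    unfolding K_def using \<rho> \<epsilon> of_int_ceiling_le_add_one[of "\<rho> * norm v / (2 * \<epsilon>)"] by (simp add: of_nat_nat)
  then have "\<epsilon> * (2 * real K + 1) \<le> \<epsilon> * (2 * (\<rho> * norm v / (2 * \<epsilon>) + 1) + 1)"
    using \<epsilon> by (intro mult_left_mono) auto
  also have "\<dots> = \<rho> * norm v + 3 * \<epsilon>" using \<epsilon> by (simp add: field_simps)
  also have "\<dots> \<le> 4 * \<rho> * norm v" using \<epsilon> by simp
  finally have 2: "\<epsilon> * (2 * real K + 1) \<le> 4 * \<rho> * norm v" .
  have "\<epsilon> * measure lborel (ball c (\<rho>/4)) \<le> \<epsilon> * (2 * real K + 1) * measure lborel T"
    using mult_left_mono[OF 1, of \<epsilon>] \<epsilon> by (simp add: mult.assoc)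
  also have "\<dots> \<le> 4 * \<rho> * norm v * measure lborel T"
    using 2 by (intro mult_right_mono) auto
  finally show ?thesis
    using measure_translation[of c "ball 0 (\<rho>/4)"] by (simp add: T_def measure_completion)
qed


subsection \<open>Integration by parts for softmax weights\<close>

text \<open>Bridge between the Lebesgue integral and the gauge integral over a box, for which the
  Leibniz rule is stated.\<close>

lemma integral_lborel_eq_integral_cbox:
  fixes f :: "'a::euclidean_space \<Rightarrow> real"
  assumes f: "continuous_on UNIV f" and zero: "\<And>x. x \<notin> cbox a b \<Longrightarrow> f x = 0"
  shows "integrable lborel f" "integral\<^sup>L lborel f = integral (cbox a b) f"
proof -
  have eq: "(\<lambda>x. indicator (cbox a b) x * f x) = f"
    using zero by (auto simp: indicator_def fun_eq_iff)
  have "set_integrable lborel (cbox a b) f"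
    unfolding set_integrable_def
    by (rule borel_integrable_compact) (auto intro: continuous_on_subset[OF f])
  then show "integrable lborel f" "integral\<^sup>L lborel f = integral (cbox a b) f"
    using set_borel_integral_eq_integral(2)[of "cbox a b" f]
    by (simp_all add: set_integrable_def set_lebesgue_integral_def eq)
qed

lemma integrable_lborel_bounded_support:
  fixes f :: "'a::euclidean_space \<Rightarrow> real"
  assumes "continuous_on UNIV f" "\<And>x. norm x > r \<Longrightarrow> f x = 0"
  shows "integrable lborel f"
proof -
  obtain a b where ab: "cball 0 r \<subseteq> cbox a (b::'a)"
    by (meson bounded_cball bounded_subset_cbox_symmetric)
  show ?thesis
    by (rule integral_lborel_eq_integral_cbox[OF assms(1), of a b])
       (use ab assms(2) in force)
qed

lemma integral_lborel_translation:
  fixes f :: "'a::euclidean_space \<Rightarrow> real"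
  assumes "f \<in> borel_measurable borel"
  shows "integral\<^sup>L lborel (\<lambda>x. f (x + c)) = integral\<^sup>L lborel f"
proof -
  have "integral\<^sup>L lborel f = integral\<^sup>L (distr lborel borel ((+) c)) f"
    by (simp add: lborel_distr_plus)
  also have "\<dots> = integral\<^sup>L lborel (\<lambda>x. f (x + c))"
    using assms by (subst integral_distr) (auto simp: add.commute)
  finally show ?thesis by simp
qed

text \<open>By translation invariance the integral of \<open>F (x + s *\<^sub>R v)\<close> does not
  depend on \<open>s\<close>. Differentiating it under the integral sign at \<open>s = 0\<close>
  gives the claim.\<close>

lemma integral_directional_derivative_eq_0:
  fixes F F' :: "'a::euclidean_space \<Rightarrow> real"
  assumes der: "\<And>x. ((\<lambda>s. F (x + s *\<^sub>R v)) has_real_derivative F' x) (at 0)"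
    and cont: "continuous_on UNIV F" "continuous_on UNIV F'"
    and supp: "\<And>x. norm x > r \<Longrightarrow> F x = 0" "\<And>x. norm x > r \<Longrightarrow> F' x = 0"
  shows "integral\<^sup>L lborel F' = 0"
proof -
  obtain a b where ab: "cball 0 (r + norm v) \<subseteq> cbox a (b::'a)"
    by (meson bounded_cball bounded_subset_cbox_symmetric)
  \<comment> \<open>The margin \<open>norm v\<close> in the choice of the box lets one fixed box
    contain the supports of all shifts with \<open>\<bar>s\<bar> < 1\<close>.\<close>
  have out: "norm (x + s *\<^sub>R v) > r" if "x \<notin> cbox a b" "\<bar>s\<bar> < 1" for x and s :: real
  proof -
    have "norm x > r + norm v" using ab that by force
    moreover have "norm x \<le> norm (x + s *\<^sub>R v) + norm (s *\<^sub>R v)"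
      using norm_triangle_ineq4[of "x + s *\<^sub>R v" "s *\<^sub>R v"] by simp
    moreover have "\<bar>s\<bar> * norm v \<le> 1 * norm v" using that by (intro mult_right_mono) auto
    ultimately show ?thesis by simp
  qed
  have der': "((\<lambda>s. F (x + s *\<^sub>R v)) has_real_derivative F' (x + s *\<^sub>R v)) (at s)" for x s
    using DERIV_shift[of "\<lambda>s. F (x + s *\<^sub>R v)" "F' (x + s *\<^sub>R v)" 0 s] der[of "x + s *\<^sub>R v"]
    by (simp add: algebra_simps)
  let ?G = "\<lambda>s. integral (cbox a b) (\<lambda>x. F (x + s *\<^sub>R v))"
  have 1: "(?G has_real_derivative integral (cbox a b) (\<lambda>x. F' (x + 0 *\<^sub>R v))) (at 0 within {-1<..<1})"
  proof (rule leibniz_rule_field_derivative)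
    show "((\<lambda>s. F (x + s *\<^sub>R v)) has_real_derivative F' (x + s *\<^sub>R v)) (at s within {-1<..<1})" for x s
      using der' has_field_derivative_at_within by blast
    show "(\<lambda>x. F (x + s *\<^sub>R v)) integrable_on cbox a b" for s
      by (intro integrable_continuous continuous_on_compose2[OF cont(1)] continuous_intros) auto
    show "continuous_on ({-1<..<1} \<times> cbox a b) (\<lambda>(s, x). F' (x + s *\<^sub>R v))"
      unfolding case_prod_beta
      by (intro continuous_on_compose2[OF cont(2)] continuous_intros) auto
  qed auto
  have const: "?G s = integral\<^sup>L lborel F" if "s \<in> {-1<..<1}" for s
  proof -
    have "integral\<^sup>L lborel F = integral\<^sup>L lborel (\<lambda>x. F (x + s *\<^sub>R v))"
      using borel_measurable_continuous_onI[OF cont(1)] by (simp add: integral_lborel_translation)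
    also have "\<dots> = ?G s"
      using out that
      by (intro integral_lborel_eq_integral_cbox(2) continuous_on_compose2[OF cont(1)] continuous_intros supp(1)) auto
    finally show ?thesis by simp
  qed
  have "(?G has_real_derivative 0) (at 0)"
    by (rule has_field_derivative_transform_within_open[where f="\<lambda>_. integral\<^sup>L lborel F" and S="{-1<..<1}"])
       (auto simp: const)
  moreover have "(?G has_real_derivative integral (cbox a b) F') (at 0)"
    using 1 at_within_open[of 0 "{-1<..<1::real}"] by simp
  ultimately have "integral (cbox a b) F' = 0" by (rule DERIV_unique[symmetric])
  moreover have "integral\<^sup>L lborel F' = integral (cbox a b) F'"
    using out[of _ 0] by (intro integral_lborel_eq_integral_cbox(2)[OF cont(2)] supp(2)) auto
  ultimately show ?thesis by simp
qed

section \<open>A compactly supported rotation invariant weight and its potential\<close>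

lemma has_real_derivative_max_0_power2:
  "((\<lambda>x::real. (max 0 x)\<^sup>2) has_real_derivative 2 * max 0 x) (at x)"
proof (cases x "0::real" rule: linorder_cases)
  case less
  have "((\<lambda>x::real. 0) has_real_derivative 0) (at x)" by simp
  then have "((\<lambda>x::real. (max 0 x)\<^sup>2) has_real_derivative 0) (at x)"
    by (rule has_field_derivative_transform_within_open[where S="{..<0}"]) (use less in auto)
  then show ?thesis using less by simp
next
  case greater
  have "((\<lambda>x::real. x\<^sup>2) has_real_derivative 2 * x) (at x)" by (auto intro!: derivative_eq_intros)
  then have "((\<lambda>x::real. (max 0 x)\<^sup>2) has_real_derivative 2 * x) (at x)"
    by (rule has_field_derivative_transform_within_open[where S="{0<..}"]) (use greater in auto)
  then show ?thesis using greater by simp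
next
  case equal
  have "((\<lambda>h::real. (max 0 h)\<^sup>2 / h) \<longlongrightarrow> 0) (at 0)"
  proof (rule Lim_null_comparison)
    show "\<forall>\<^sub>F h in at 0. norm ((max 0 h)\<^sup>2 / h) \<le> \<bar>h::real\<bar>"
      by (intro always_eventually) (auto simp: max_def power2_eq_square)
    show "(abs \<longlongrightarrow> 0) (at (0::real))" by (simp add: tendsto_rabs_zero)
  qed
  then show ?thesis using equal by (simp add: DERIV_def)
qed

text \<open>It depends on \<open>x \<bullet> x\<close> only and vanishes off the unit ball, hence
  there are no boundary terms. Being linear in \<open>x \<bullet> x\<close> inside the ball, it has
  an explicit continuously differentiable potential.\<close>

definition bump :: "'a::euclidean_space \<Rightarrow> real"
  where "bump x = max 0 (1 - x \<bullet> x)"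

definition bump_potential :: "'a::euclidean_space \<Rightarrow> real"
  where "bump_potential x = (max 0 (1 - x \<bullet> x))\<^sup>2 / 4"

lemma bump_nonneg: "0 \<le> bump x" and bump_potential_nonneg: "0 \<le> bump_potential x"
  by (simp_all add: bump_def bump_potential_def)

lemma inner_self_gt_1: "norm x > 1 \<Longrightarrow> x \<bullet> x > (1::real)"
  by (simp add: dot_square_norm)

lemma bump_eq_0: "norm x > 1 \<Longrightarrow> bump x = 0"
  and bump_potential_eq_0: "norm x > 1 \<Longrightarrow> bump_potential x = 0"
  using inner_self_gt_1[of x] by (simp_all add: bump_def bump_potential_def)

lemma continuous_on_bump: "continuous_on A bump"
  and continuous_on_bump_potential: "continuous_on A bump_potential"
  unfolding bump_def[abs_def] bump_potential_def[abs_def] by (intro continuous_intros; simp)+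

lemma bump_potential_directional_derivative:
  "((\<lambda>s. bump_potential (x + s *\<^sub>R v)) has_real_derivative - (v \<bullet> x) * bump x) (at 0)"
proof -
  have "((\<lambda>s. 1 - (x + s *\<^sub>R v) \<bullet> (x + s *\<^sub>R v)) has_real_derivative - 2 * (v \<bullet> x)) (at 0)"
    by (auto intro!: derivative_eq_intros simp: inner_add_left inner_add_right inner_commute)
  from DERIV_chain2[OF has_real_derivative_max_0_power2 this]
  have "((\<lambda>s. (max 0 (1 - (x + s *\<^sub>R v) \<bullet> (x + s *\<^sub>R v)))\<^sup>2) has_real_derivative
     2 * bump x * (- 2 * (v \<bullet> x))) (at 0)" by (simp add: bump_def)
  from DERIV_cdivide[OF this, of 4] show ?thesis
    by (simp add: bump_potential_def mult_ac)
qed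

section \<open>Calculus of softmax weights and of the log-sum-exp function\<close>

definition softmax :: "nat \<Rightarrow> (nat \<Rightarrow> real) \<Rightarrow> nat \<Rightarrow> real"
  where "softmax N a k = exp (a k) / (\<Sum>l<N. exp (a l))"

definition log_sum_exp :: "nat \<Rightarrow> (nat \<Rightarrow> real) \<Rightarrow> real"
  where "log_sum_exp N a = ln (\<Sum>l<N. exp (a l))"

lemma sum_exp_pos: "(N::nat) \<ge> 1 \<Longrightarrow> (\<Sum>l<N. exp (a l :: real)) > 0"
  by (intro sum_pos) (auto simp: lessThan_empty_iff)

lemma softmax_nonneg: "0 \<le> softmax N a k"
  by (simp add: softmax_def sum_nonneg)

lemma sum_softmax: "N \<ge> 1 \<Longrightarrow> (\<Sum>k<N. softmax N a k) = 1"
  using sum_exp_pos[of N a] by (simp add: softmax_def flip: sum_divide_distrib)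

lemma has_real_derivative_log_sum_exp:
  assumes "N \<ge> 1" "\<And>k. k < N \<Longrightarrow> ((\<lambda>t. a t k) has_real_derivative a' k) (at t)"
  shows "((\<lambda>t. log_sum_exp N (a t)) has_real_derivative (\<Sum>k<N. softmax N (a t) k * a' k)) (at t)"
  unfolding log_sum_exp_def
  using assms(2) sum_exp_pos[OF assms(1), of "a t"]
  by (auto intro!: derivative_eq_intros simp: softmax_def sum_divide_distrib)

lemma has_real_derivative_softmax:
  assumes "N \<ge> 1" "\<And>k. k < N \<Longrightarrow> ((\<lambda>t. a t k) has_real_derivative a' k) (at t)" "k < N"
  shows "((\<lambda>t. softmax N (a t) k) has_real_derivative
    softmax N (a t) k * (a' k - (\<Sum>l<N. softmax N (a t) l * a' l))) (at t)"
proof -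
  let ?s = "\<lambda>t. \<Sum>l<N. exp (a t l)"
  have s: "?s t \<noteq> 0" using sum_exp_pos[OF assms(1), of "a t"] by simp
  have ek: "((\<lambda>t. exp (a t k)) has_real_derivative exp (a t k) * a' k) (at t)"
    using assms(2)[OF assms(3)] by (auto intro!: derivative_eq_intros)
  have es: "(?s has_real_derivative (\<Sum>l<N. exp (a t l) * a' l)) (at t)"
    using assms(2) by (auto intro!: derivative_eq_intros)
  have sm: "(\<Sum>l<N. softmax N (a t) l * a' l) = (\<Sum>l<N. exp (a t l) * a' l) / ?s t"
    by (simp add: softmax_def sum_divide_distrib)
  show ?thesis
    unfolding sm using DERIV_divide[OF ek es s] s
    by (simp add: softmax_def field_simps power2_eq_square)
qed

lemma continuous_on_softmax:
  assumes "N \<ge> 1" "\<And>k. k < N \<Longrightarrow> continuous_on A (\<lambda>x. a x k)" "k < N"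
  shows "continuous_on A (\<lambda>x. softmax N (a x) k)"
  unfolding softmax_def
  using assms sum_exp_pos[OF assms(1)] by (auto intro!: continuous_intros simp: less_imp_neq[symmetric])

lemma continuous_on_log_sum_exp:
  assumes "N \<ge> 1" "\<And>k. k < N \<Longrightarrow> continuous_on A (\<lambda>x. a x k)"
  shows "continuous_on A (\<lambda>x. log_sum_exp N (a x))"
  unfolding log_sum_exp_def
  using assms sum_exp_pos[OF assms(1)] by (auto intro!: continuous_intros simp: less_imp_neq[symmetric])

text \<open>Integration by parts, using that \<open>bump_potential\<close> has gradient \<open>- bump x *\<^sub>R x\<close>.\<close>

lemma integral_softmax_inner_bump:
  fixes Z :: "nat \<Rightarrow> 'a::euclidean_space"
  assumes N: "N \<ge> 1" "k < N"
  shows "(\<integral>x. softmax N (\<lambda>l. Z l \<bullet> x) k * (v \<bullet> x) * bump x \<partial>lborel) =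
    (\<integral>x. softmax N (\<lambda>l. Z l \<bullet> x) k *
       (Z k \<bullet> v - (\<Sum>l<N. softmax N (\<lambda>l. Z l \<bullet> x) l * (Z l \<bullet> v))) * bump_potential x \<partial>lborel)"
    (is "integral\<^sup>L _ ?L = integral\<^sup>L _ ?R")
proof -
  have sm: "continuous_on UNIV (\<lambda>x. softmax N (\<lambda>l. Z l \<bullet> x) k)" if "k < N" for k
    using that by (intro continuous_on_softmax N continuous_intros)
  have cL: "continuous_on UNIV ?L" and cR: "continuous_on UNIV ?R"
    by (intro continuous_intros sm N continuous_on_bump continuous_on_bump_potential; simp)+
  have iL: "integrable lborel ?L" and iR: "integrable lborel ?R"
    using integrable_lborel_bounded_support[OF cL, of 1] integrable_lborel_bounded_support[OF cR, of 1]
    by (simp_all add: bump_eq_0 bump_potential_eq_0)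
  have "integral\<^sup>L lborel (\<lambda>x. ?R x - ?L x) = 0"
  \<comment> \<open>Applied to the softmax weight times \<open>bump_potential\<close>: the product
    rule produces the two integrands with opposite signs.\<close>
  proof (rule integral_directional_derivative_eq_0[where r=1])
    fix x
    have "((\<lambda>s. softmax N (\<lambda>l. Z l \<bullet> (x + s *\<^sub>R v)) k) has_real_derivative
      softmax N (\<lambda>l. Z l \<bullet> (x + 0 *\<^sub>R v)) k *
        (Z k \<bullet> v - (\<Sum>l<N. softmax N (\<lambda>l. Z l \<bullet> (x + 0 *\<^sub>R v)) l * (Z l \<bullet> v)))) (at 0)"
      by (intro has_real_derivative_softmax N) (auto intro!: derivative_eq_intros simp: inner_add_right)
    from DERIV_mult[OF this bump_potential_directional_derivative[of x v]]
    show "((\<lambda>s. softmax N (\<lambda>l. Z l \<bullet> (x + s *\<^sub>R v)) k * bump_potential (x + s *\<^sub>R v)) has_real_derivative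
        ?R x - ?L x) (at 0)"
      by (simp add: algebra_simps)
  qed (auto intro!: continuous_intros sm N cL cR continuous_on_bump_potential
        simp: bump_eq_0 bump_potential_eq_0)
  then show ?thesis using iL iR by simp
qed


text \<open>Under weights of total mass 1 the left side is the covariance of \<open>Z\<close> and
  \<open>V\<close>. A covariance is half the mean of the product of differences over two independent
  copies.\<close>

lemma softmax_symmetrise:
  fixes s :: "nat \<Rightarrow> real" and Z V :: "nat \<Rightarrow> 'a::real_inner"
  assumes "(\<Sum>k<N. s k) = 1"
  shows "(\<Sum>k<N. s k * (Z k \<bullet> V k - (\<Sum>l<N. s l * (Z l \<bullet> V k)))) =
    (\<Sum>k<N. \<Sum>l<N. s k * s l * ((Z k - Z l) \<bullet> (V k - V l))) / 2"
proof -
  define D where "D = (\<Sum>k<N. s k * (Z k \<bullet> V k))"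
  define C where "C = (\<Sum>k<N. \<Sum>l<N. s k * s l * (Z l \<bullet> V k))"
  have 1: "(\<Sum>k<N. \<Sum>l<N. s k * s l * (Z k \<bullet> V k)) = D"
  proof -
    have "(\<Sum>l<N. s k * s l * (Z k \<bullet> V k)) = s k * (Z k \<bullet> V k) * (\<Sum>l<N. s l)" for k
      unfolding sum_distrib_left by (intro sum.cong refl) (simp add: mult_ac)
    then show ?thesis using assms by (simp add: D_def)
  qed
  have 2: "(\<Sum>k<N. \<Sum>l<N. s k * s l * (Z l \<bullet> V l)) = D"
    by (subst sum.swap) (use 1 in \<open>simp add: mult.commute\<close>)
  have 3: "(\<Sum>k<N. \<Sum>l<N. s k * s l * (Z k \<bullet> V l)) = C"
    unfolding C_def by (subst sum.swap) (simp add: mult.commute)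
  have "(\<Sum>k<N. \<Sum>l<N. s k * s l * ((Z k - Z l) \<bullet> (V k - V l))) = D + D - C - C"
  proof -
    have "s k * s l * ((Z k - Z l) \<bullet> (V k - V l)) = s k * s l * (Z k \<bullet> V k) + s k * s l * (Z l \<bullet> V l)
       - s k * s l * (Z l \<bullet> V k) - s k * s l * (Z k \<bullet> V l)" for k l
      by (simp add: inner_diff_left inner_diff_right algebra_simps)
    then show ?thesis by (simp only: sum.distrib sum_subtractf 1 2 3 flip: C_def)
  qed
  moreover have "(\<Sum>k<N. s k * (Z k \<bullet> V k - (\<Sum>l<N. s l * (Z l \<bullet> V k)))) = D - C"
    by (simp add: D_def C_def right_diff_distrib sum_subtractf sum_distrib_left mult.assoc)
  ultimately show ?thesis by simp
qed

text \<open>A quarter turn from \<open>A\<close> at time 0 to \<open>B\<close> at time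
  \<open>pi/2\<close>. If \<open>A\<close> and \<open>B\<close> lie in orthogonal subspaces, squared
  distances are mixed with the coefficients \<open>(cos t)\<^sup>2\<close> and
  \<open>(sin t)\<^sup>2\<close>.\<close>

definition rotated :: "(nat \<Rightarrow> 'a::real_vector) \<Rightarrow> (nat \<Rightarrow> 'a) \<Rightarrow> real \<Rightarrow> nat \<Rightarrow> 'a"
  where "rotated A B t k = cos t *\<^sub>R A k + sin t *\<^sub>R B k"

text \<open>Differentiation under the integral gives the softmax mean of
  \<open>velocity \<bullet> x\<close>. Integration by parts replaces the factor \<open>x\<close> by
  a covariance of positions and velocities, and symmetrising it leaves only pairwise differences,
  which are controlled by the distances.\<close>

lemma has_real_derivative_integral_log_sum_exp:
  fixes A B :: "nat \<Rightarrow> 'a::euclidean_space"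
  assumes N: "N \<ge> 1" and orth: "\<And>k l. A k \<bullet> B l = 0"
  shows "((\<lambda>t. \<integral>x. log_sum_exp N (\<lambda>k. rotated A B t k \<bullet> x) * bump x \<partial>lborel) has_real_derivative
    sin t * cos t / 2 * (\<integral>x. (\<Sum>k<N. \<Sum>l<N. softmax N (\<lambda>k. rotated A B t k \<bullet> x) k *
       softmax N (\<lambda>k. rotated A B t k \<bullet> x) l * ((norm (B k - B l))\<^sup>2 - (norm (A k - A l))\<^sup>2)) *
       bump_potential x \<partial>lborel)) (at t)"
proof -
  define V where "V = (\<lambda>t k. (- sin t) *\<^sub>R A k + cos t *\<^sub>R B k)"
  define s where "s = (\<lambda>t x. softmax N (\<lambda>k. rotated A B t k \<bullet> x))"
  obtain a b where ab: "cball 0 1 \<subseteq> cbox a (b::'a)"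
    by (meson bounded_cball bounded_subset_cbox_symmetric)
  have out: "norm x > 1" if "x \<notin> cbox a b" for x using ab that by force
  have cs: "continuous_on UNIV (\<lambda>x. s t x k)" if "k < N" for t k
    unfolding s_def using that by (intro continuous_on_softmax N continuous_intros)
  have lse: "continuous_on UNIV (\<lambda>x. log_sum_exp N (\<lambda>k. rotated A B t k \<bullet> x) * bump x)" for t
    by (intro continuous_intros continuous_on_log_sum_exp N continuous_on_bump)
  have eq: "(\<integral>x. log_sum_exp N (\<lambda>k. rotated A B t k \<bullet> x) * bump x \<partial>lborel) =
     integral (cbox a b) (\<lambda>x. log_sum_exp N (\<lambda>k. rotated A B t k \<bullet> x) * bump x)" for t
    using out by (intro integral_lborel_eq_integral_cbox(2)[OF lse]) (simp add: bump_eq_0)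
  have "((\<lambda>t. integral (cbox a b) (\<lambda>x. log_sum_exp N (\<lambda>k. rotated A B t k \<bullet> x) * bump x)) has_real_derivative
    integral (cbox a b) (\<lambda>x. (\<Sum>k<N. s t x k * (V t k \<bullet> x)) * bump x)) (at t within UNIV)"
  proof (rule leibniz_rule_field_derivative)
    fix t x
    have "((\<lambda>t. log_sum_exp N (\<lambda>k. rotated A B t k \<bullet> x)) has_real_derivative
        (\<Sum>k<N. s t x k * (V t k \<bullet> x))) (at t)"
      unfolding s_def
      by (rule has_real_derivative_log_sum_exp[OF N])
         (auto intro!: derivative_eq_intros simp: rotated_def V_def inner_add_left inner_diff_left)
    from DERIV_cmult_right[OF this]
    show "((\<lambda>t. log_sum_exp N (\<lambda>k. rotated A B t k \<bullet> x) * bump x) has_real_derivative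
        (\<Sum>k<N. s t x k * (V t k \<bullet> x)) * bump x) (at t within UNIV)" by simp
    show "(\<lambda>x. log_sum_exp N (\<lambda>k. rotated A B t k \<bullet> x) * bump x) integrable_on cbox a b"
      by (intro integrable_continuous continuous_on_subset[OF lse]) auto
  next
    have "continuous_on (UNIV \<times> cbox a b) (\<lambda>z. s (fst z) (snd z) k)" if "k < N" for k
      unfolding s_def rotated_def using that
      by (intro continuous_on_softmax N continuous_intros)
    then show "continuous_on (UNIV \<times> cbox a b) (\<lambda>(t, x). (\<Sum>k<N. s t x k * (V t k \<bullet> x)) * bump x)"
      unfolding case_prod_beta V_def
      by (intro continuous_intros continuous_on_compose2[OF continuous_on_bump[of UNIV]]) auto
  qed auto
  moreover have "integral (cbox a b) (\<lambda>x. (\<Sum>k<N. s t x k * (V t k \<bullet> x)) * bump x) =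
     (\<integral>x. (\<Sum>k<N. s t x k * (V t k \<bullet> x)) * bump x \<partial>lborel)"
    using out cs
    by (intro integral_lborel_eq_integral_cbox(2)[symmetric] continuous_intros continuous_on_bump)
       (auto simp: bump_eq_0)
  moreover have "\<dots> = (\<Sum>k<N. \<integral>x. s t x k * (V t k \<bullet> x) * bump x \<partial>lborel)"
    unfolding sum_distrib_right using cs
    by (intro Bochner_Integration.integral_sum integrable_lborel_bounded_support[where r=1] continuous_intros continuous_on_bump)
       (auto simp: bump_eq_0)
  moreover have "\<dots> = (\<Sum>k<N. \<integral>x. s t x k * (rotated A B t k \<bullet> V t k -
      (\<Sum>l<N. s t x l * (rotated A B t l \<bullet> V t k))) * bump_potential x \<partial>lborel)"
    unfolding s_def by (intro sum.cong refl integral_softmax_inner_bump N) auto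
  moreover have "\<dots> = (\<integral>x. (\<Sum>k<N. s t x k * (rotated A B t k \<bullet> V t k -
      (\<Sum>l<N. s t x l * (rotated A B t l \<bullet> V t k)))) * bump_potential x \<partial>lborel)"
    unfolding sum_distrib_right using cs
    by (intro Bochner_Integration.integral_sum[symmetric] integrable_lborel_bounded_support[where r=1]
          continuous_intros continuous_on_bump_potential)
       (auto simp: bump_potential_eq_0)
  moreover have "\<dots> = (\<integral>x. sin t * cos t / 2 * ((\<Sum>k<N. \<Sum>l<N. s t x k * s t x l *
      ((norm (B k - B l))\<^sup>2 - (norm (A k - A l))\<^sup>2)) * bump_potential x) \<partial>lborel)"
  proof (intro Bochner_Integration.integral_cong refl)
    fix x
    \<comment> \<open>This is half the time derivative of the squared distance of points
      \<open>k\<close> and \<open>l\<close>. Orthogonality removes the mixed terms, whose sign would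
      be unknown.\<close>
    have *: "(rotated A B t k - rotated A B t l) \<bullet> (V t k - V t l) =
       sin t * cos t * ((norm (B k - B l))\<^sup>2 - (norm (A k - A l))\<^sup>2)" for k l
    proof -
      have r: "rotated A B t k - rotated A B t l = cos t *\<^sub>R (A k - A l) + sin t *\<^sub>R (B k - B l)"
        "V t k - V t l = (- sin t) *\<^sub>R (A k - A l) + cos t *\<^sub>R (B k - B l)"
        by (simp_all add: rotated_def V_def algebra_simps)
      have o: "(A k - A l) \<bullet> (B k - B l) = 0"
        using orth by (simp add: inner_diff_left inner_diff_right)
      have "(cos t *\<^sub>R a + sin t *\<^sub>R b) \<bullet> ((- sin t) *\<^sub>R a + cos t *\<^sub>R b) =
          sin t * cos t * (b \<bullet> b - a \<bullet> a)" if "a \<bullet> b = 0" for a b :: 'a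
        using that by (simp add: inner_add_left inner_diff_right inner_commute[of b a] algebra_simps)
      from this[OF o] show ?thesis unfolding r power2_norm_eq_inner .
    qed
    have "(\<Sum>k<N. s t x k) = 1" unfolding s_def by (rule sum_softmax[OF N])
    from softmax_symmetrise[OF this, of "rotated A B t" "V t"]
    show "(\<Sum>k<N. s t x k * (rotated A B t k \<bullet> V t k -
      (\<Sum>l<N. s t x l * (rotated A B t l \<bullet> V t k)))) * bump_potential x =
      sin t * cos t / 2 * ((\<Sum>k<N. \<Sum>l<N. s t x k * s t x l *
      ((norm (B k - B l))\<^sup>2 - (norm (A k - A l))\<^sup>2)) * bump_potential x)"
      unfolding * by (simp add: sum_distrib_left sum_distrib_right sum_divide_distrib mult_ac)
  qed
  ultimately show ?thesis unfolding eq s_def by simp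
qed

text \<open>The error \<open>ln (real N)\<close> does not depend on the size of \<open>a\<close>.
  Hence it becomes negligible relative to the maximum when \<open>a\<close> is scaled by a large
  \<open>\<beta>\<close>.\<close>

lemma log_sum_exp_bounds:
  assumes "N \<ge> 1"
  shows "Max (a ` {..<N}) \<le> log_sum_exp N a" "log_sum_exp N a \<le> Max (a ` {..<N}) + ln (real N)"
proof -
  have ne: "a ` {..<N} \<noteq> {}" using assms by (auto simp: lessThan_empty_iff)
  let ?m = "Max (a ` {..<N})"
  obtain k where k: "k < N" "?m = a k" using Max_in[OF _ ne] by auto
  have "exp ?m \<le> (\<Sum>l<N. exp (a l))"
    unfolding k(2) using k(1) by (intro member_le_sum) auto
  then show "?m \<le> log_sum_exp N a"
    unfolding log_sum_exp_def using sum_exp_pos[OF assms, of a] by (subst ln_ge_iff) auto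
  have "(\<Sum>l<N. exp (a l)) \<le> (\<Sum>l<N. exp ?m)" by (intro sum_mono) auto
  then have "(\<Sum>l<N. exp (a l)) \<le> real N * exp ?m" by simp
  then have "log_sum_exp N a \<le> ln (real N * exp ?m)"
    unfolding log_sum_exp_def using sum_exp_pos[OF assms, of a] by (intro ln_mono) auto
  also have "\<dots> = ?m + ln (real N)" using assms by (simp add: ln_mult)
  finally show "log_sum_exp N a \<le> ?m + ln (real N)" .
qed


subsection \<open>Strict monotonicity of the mean width\<close>

lemma continuous_on_Max_image:
  fixes f :: "'i \<Rightarrow> 'a::topological_space \<Rightarrow> real"
  assumes "finite I" "I \<noteq> {}" "\<And>i. i \<in> I \<Longrightarrow> continuous_on A (f i)"
  shows "continuous_on A (\<lambda>x. Max ((\<lambda>i. f i x) ` I))"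
  using assms
proof (induction rule: finite_ne_induct)
  case (insert i I)
  then show ?case by (simp add: continuous_on_max)
qed simp

lemma softmax_ge:
  assumes "N \<ge> 1" "\<And>l. l < N \<Longrightarrow> a l - a k \<le> 1"
  shows "1 / (real N * exp 1) \<le> softmax N a k"
proof -
  have "(\<Sum>l<N. exp (a l)) \<le> (\<Sum>l<N. exp (1 + a k))"
    using assms(2) by (intro sum_mono) (force simp: diff_le_eq)
  then have "(\<Sum>l<N. exp (a l)) \<le> real N * exp 1 * exp (a k)" by (simp add: exp_add)
  then show ?thesis
    unfolding softmax_def using sum_exp_pos[OF assms(1), of a] assms(1)
    by (simp add: divide_simps mult_ac)
qed

lemma integral_ge_measure:
  fixes f :: "'a::euclidean_space \<Rightarrow> real"
  assumes "integrable lborel f" "\<And>x. 0 \<le> f x" "T \<in> sets lborel" "bounded T" "\<And>x. x \<in> T \<Longrightarrow> K \<le> f x"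
  shows "K * measure lborel T \<le> integral\<^sup>L lborel f"
proof -
  have fin: "emeasure lborel T < \<infinity>" using emeasure_bounded_finite assms(4) by blast
  then have "K * measure lborel T = (\<integral>x. K * indicator T x \<partial>lborel)" using assms(3) by simp
  also have "\<dots> \<le> integral\<^sup>L lborel f"
    using assms fin
    by (intro integral_mono Bochner_Integration.integrable_mult_right integrable_real_indicator) (auto simp: indicator_def)
  finally show ?thesis .
qed

lemma cos_sin_ge_half:
  assumes "pi/6 \<le> t" "t \<le> pi/3"
  shows "cos t \<ge> 1/2" "sin t \<ge> 1/2"
proof -
  have "cos (pi/3) \<le> cos t" using assms pi_gt_zero by (intro cos_monotone_0_pi_le) auto
  then show "cos t \<ge> 1/2" by (simp add: cos_60)
  have "sin (pi/6) \<le> sin t" using assms pi_gt_zero by (intro sin_monotone_2pi_le) auto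
  then show "sin t \<ge> 1/2" by (simp add: sin_30)
qed

text \<open>The function \<open>J \<beta> t\<close> below is the weighted integral of the smoothed
  maximum at scale \<open>\<beta>\<close>. It is nondecreasing on the whole path and increases at
  rate at least \<open>\<beta> * c\<close> for \<open>t\<close> between \<open>pi/6\<close> and
  \<open>pi/3\<close>. Its end values differ from \<open>\<beta>\<close> times the two integrals by
  at most a constant independent of \<open>\<beta>\<close>.\<close>

lemma integral_Max_inner_strict_mono:
  fixes p q :: "nat \<Rightarrow> 'a::euclidean_space"
  assumes N: "N \<ge> 1"
    and le: "\<And>i j. i < N \<Longrightarrow> j < N \<Longrightarrow> norm (p i - p j) \<le> norm (q i - q j)"
    and strict: "i0 < N" "j0 < N" "norm (p i0 - p j0) < norm (q i0 - q j0)"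
  shows "(\<integral>z. Max ((\<lambda>k. p k \<bullet> fst z) ` {..<N}) * bump (z::'a\<times>'a) \<partial>lborel) <
    (\<integral>z. Max ((\<lambda>k. q k \<bullet> snd z) ` {..<N}) * bump (z::'a\<times>'a) \<partial>lborel)"
proof -
  define z where "z = (\<lambda>k. (p k, q k))"
  define A where "A = (\<lambda>k. (p k, 0::'a))"
  define B where "B = (\<lambda>k. (0::'a, q k))"
  define F where "F = (\<lambda>u v :: 'a \<times> 'a. snd u \<bullet> snd v - fst u \<bullet> fst v)"
  have bil: "bilinear F"
    by (auto simp: bilinear_def F_def inner_add_left inner_add_right algebra_simps intro!: linearI)
  have sym: "F u v = F v u" for u v by (simp add: F_def inner_commute)
  have Fz: "F (z k - z l) (z k - z l) = (norm (q k - q l))\<^sup>2 - (norm (p k - p l))\<^sup>2" for k l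
    by (simp add: F_def z_def power2_norm_eq_inner)
  have le2: "(norm (p k - p l))\<^sup>2 \<le> (norm (q k - q l))\<^sup>2" if "k < N" "l < N" for k l
    using le[OF that] by (intro power_mono) auto
  have F0: "F (z i0 - z j0) (z i0 - z j0) > 0"
    unfolding Fz using strict(3) by (simp add: power_strict_mono)
  obtain v w g' where vw: "v \<in> z ` {..<N}" "w \<in> z ` {..<N}" "F (w - v) (w - v) > 0" "g' \<bullet> w = g' \<bullet> v"
    "\<And>x. x \<in> z ` {..<N} \<Longrightarrow> x \<in> closed_segment v w \<or> g' \<bullet> x < g' \<bullet> v"
  proof (rule exists_positive_edge[OF bil sym _ _ _ _ F0])
    show "F (x - y) (x - y) \<ge> 0" if "x \<in> z ` {..<N}" "y \<in> z ` {..<N}" for x y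
      using that le2 by (auto simp: Fz)
  qed (use strict in auto)
  then obtain i j where ij: "i < N" "j < N" "v = z i" "w = z j" by auto
  define \<gamma> where "\<gamma> = F (z j - z i) (z j - z i)"
  have \<gamma>: "\<gamma> > 0" using vw ij by (simp add: \<gamma>_def)
  \<comment> \<open>The edge functional may be rescaled freely. This scale gives
    \<open>norm g \<le> 1/8\<close>, hence \<open>norm (G t) \<le> 1/4\<close>, so a ball of radius
    at most \<open>1/4\<close> around \<open>G t\<close> stays where \<open>bump_potential\<close>
    is at least \<open>1/8\<close>.\<close>
  define \<tau> where "\<tau> = 1 / (8 * (norm g' + 1))"
  have \<tau>: "\<tau> > 0" by (simp add: \<tau>_def add_nonneg_pos)
  define g where "g = \<tau> *\<^sub>R g'"
  have ng: "norm g \<le> 1/8"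
    using \<tau> by (simp add: g_def) (simp add: \<tau>_def field_simps)
  have gij: "g \<bullet> z j = g \<bullet> z i" using vw ij by (simp add: g_def)
  have gk: "z k \<in> closed_segment (z i) (z j) \<or> g \<bullet> z k < g \<bullet> z i" if "k < N" for k
    using vw(5)[of "z k"] that ij \<tau> by (auto simp: g_def)
  define I where "I = {k. k < N \<and> z k \<notin> closed_segment (z i) (z j)}"
  obtain \<delta> where \<delta>: "\<delta> > 0" "\<And>k. k \<in> I \<Longrightarrow> g \<bullet> z k + \<delta> \<le> g \<bullet> z i"
  proof -
    \<comment> \<open>The inserted 1 covers the case that all points lie on the edge and
      \<open>I\<close> is empty.\<close>
    define \<delta> where "\<delta> = Min (insert 1 ((\<lambda>k. g \<bullet> z i - g \<bullet> z k) ` I))"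
    have fin: "finite I" by (simp add: I_def)
    have "\<delta> > 0" unfolding \<delta>_def using gk fin by (subst Min_gr_iff) (auto simp: I_def)
    moreover have "\<delta> \<le> g \<bullet> z i - g \<bullet> z k" if "k \<in> I" for k
      unfolding \<delta>_def using fin that by (intro Min_le) auto
    ultimately show ?thesis by (intro that[of \<delta>]) (auto simp: algebra_simps)
  qed
  define R where "R = 1 + (\<Sum>k<N. \<Sum>l<N. norm (z k - z l))"
  have R: "norm (z k - z l) \<le> R" if "k < N" "l < N" for k l
  proof -
    have "norm (z k - z l) \<le> (\<Sum>l<N. norm (z k - z l))" using that by (intro member_le_sum) auto
    also have "\<dots> \<le> (\<Sum>k<N. \<Sum>l<N. norm (z k - z l))"
      using that by (intro member_le_sum[where f="\<lambda>k. \<Sum>l<N. norm (z k - z l)"] sum_nonneg) auto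
    finally show ?thesis by (simp add: R_def)
  qed
  have Rpos: "R > 0" unfolding R_def by (intro add_pos_nonneg sum_nonneg) auto
  \<comment> \<open>Moving the direction by less than \<open>\<rho>\<close> changes the difference
    of two functionals by at most \<open>R * \<rho>\<close>, so the points off the edge remain
    dominated.\<close>
  define \<rho> where "\<rho> = min (1/4) (\<delta> / R)"
  have \<rho>: "\<rho> > 0" "\<rho> \<le> 1/4" "R * \<rho> \<le> \<delta>" using \<delta> Rpos by (auto simp: \<rho>_def min_def field_simps)
  define Z where "Z = rotated A B"
  have Z: "Z t k = (cos t *\<^sub>R p k, sin t *\<^sub>R q k)" for t k by (simp add: Z_def rotated_def A_def B_def)
  have Zd: "norm (Z t k - Z t l) \<le> norm (z k - z l)" for t k l
  proof -
    have "(norm (Z t k - Z t l))\<^sup>2 = (cos t)\<^sup>2 * (norm (p k - p l))\<^sup>2 + (sin t)\<^sup>2 * (norm (q k - q l))\<^sup>2"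
      by (simp add: Z norm_Pair power_mult_distrib flip: scaleR_diff_right)
    also have "\<dots> \<le> 1 * (norm (p k - p l))\<^sup>2 + 1 * (norm (q k - q l))\<^sup>2"
      by (intro add_mono mult_right_mono) (auto simp: abs_square_le_1)
    also have "\<dots> = (norm (z k - z l))\<^sup>2" by (simp add: z_def norm_Pair)
    finally show ?thesis by (rule power2_le_imp_le) simp
  qed
  have Zd2: "norm (z k - z l) / 2 \<le> norm (Z t k - Z t l)" if t: "pi/6 \<le> t" "t \<le> pi/3" for t k l
  proof -
    have "(norm (z k - z l) / 2)\<^sup>2 = (1/2)\<^sup>2 * (norm (p k - p l))\<^sup>2 + (1/2)\<^sup>2 * (norm (q k - q l))\<^sup>2"
      by (simp add: z_def norm_Pair power_divide add_divide_distrib)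
    also have "\<dots> \<le> (cos t)\<^sup>2 * (norm (p k - p l))\<^sup>2 + (sin t)\<^sup>2 * (norm (q k - q l))\<^sup>2"
      using cos_sin_ge_half[OF t] by (intro add_mono mult_right_mono power_mono) auto
    also have "\<dots> = (norm (Z t k - Z t l))\<^sup>2"
      by (simp add: Z norm_Pair power_mult_distrib flip: scaleR_diff_right)
    finally show ?thesis by (rule power2_le_imp_le) simp
  qed
  \<comment> \<open>Transport of \<open>g\<close> by the inverse of the diagonal map at time
    \<open>t\<close>: the configuration at time \<open>t\<close> sees \<open>G t\<close> exactly as
    the points \<open>z k\<close> see \<open>g\<close>. Between \<open>pi/6\<close> and
    \<open>pi/3\<close> both divisors are at least \<open>1/2\<close>, which makes all bounds
    uniform in \<open>t\<close>.\<close>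
  define G where "G = (\<lambda>t. (fst g /\<^sub>R cos t, snd g /\<^sub>R sin t))"
  have ZG: "Z t k \<bullet> G t = g \<bullet> z k" if t: "pi/6 \<le> t" "t \<le> pi/3" for t k
  proof -
    have "cos t \<noteq> 0" "sin t \<noteq> 0" using cos_sin_ge_half[OF t] by auto
    then show ?thesis by (simp add: Z G_def z_def inner_prod_def inner_commute field_simps)
  qed
  have nG: "norm (G t) \<le> 1/4" if t: "pi/6 \<le> t" "t \<le> pi/3" for t
  proof -
    have "(norm (G t))\<^sup>2 = (inverse (cos t))\<^sup>2 * (norm (fst g))\<^sup>2 + (inverse (sin t))\<^sup>2 * (norm (snd g))\<^sup>2"
      by (simp add: G_def norm_Pair power_mult_distrib power_inverse)
    also have "\<dots> \<le> 2\<^sup>2 * (norm (fst g))\<^sup>2 + 2\<^sup>2 * (norm (snd g))\<^sup>2"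
      using cos_sin_ge_half[OF t] by (intro add_mono mult_right_mono power_mono) (auto simp: inverse_eq_divide field_simps)
    also have "\<dots> = (2 * norm g)\<^sup>2" by (simp add: norm_prod_def power_mult_distrib)
    finally have "norm (G t) \<le> 2 * norm g" by (rule power2_le_imp_le) simp
    with ng show ?thesis by simp
  qed
  define s where "s = (\<lambda>\<beta> t x. softmax N (\<lambda>k. rotated (\<lambda>k. \<beta> *\<^sub>R A k) (\<lambda>k. \<beta> *\<^sub>R B k) t k \<bullet> x))"
  have rot: "rotated (\<lambda>k. \<beta> *\<^sub>R A k) (\<lambda>k. \<beta> *\<^sub>R B k) t k \<bullet> x = \<beta> * (Z t k \<bullet> x)" for \<beta> t k x
    by (simp add: Z_def rotated_def inner_add_left algebra_simps)
  define J where "J = (\<lambda>\<beta> t. \<integral>x. log_sum_exp N (\<lambda>k. rotated (\<lambda>k. \<beta> *\<^sub>R A k) (\<lambda>k. \<beta> *\<^sub>R B k) t k \<bullet> x) * bump x \<partial>lborel)"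
  define f where "f = (\<lambda>\<beta> t x. (\<Sum>k<N. \<Sum>l<N. s \<beta> t x k * s \<beta> t x l *
    ((norm (\<beta> *\<^sub>R B k - \<beta> *\<^sub>R B l))\<^sup>2 - (norm (\<beta> *\<^sub>R A k - \<beta> *\<^sub>R A l))\<^sup>2)) * bump_potential x)"
  have J: "(J \<beta> has_real_derivative sin t * cos t / 2 * integral\<^sup>L lborel (f \<beta> t)) (at t)" for \<beta> t
    unfolding J_def f_def s_def
    by (rule has_real_derivative_integral_log_sum_exp[OF N]) (simp add: A_def B_def)
  have cs: "continuous_on UNIV (\<lambda>x. s \<beta> t x k)" if "k < N" for \<beta> t k
    unfolding s_def using that by (intro continuous_on_softmax N continuous_intros)
  have intf: "integrable lborel (f \<beta> t)" for \<beta> t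
    unfolding f_def using cs
    by (intro integrable_lborel_bounded_support[where r=1] continuous_intros continuous_on_bump_potential)
       (auto simp: bump_potential_eq_0)
  have dist: "(norm (\<beta> *\<^sub>R B k - \<beta> *\<^sub>R B l))\<^sup>2 - (norm (\<beta> *\<^sub>R A k - \<beta> *\<^sub>R A l))\<^sup>2 =
      \<beta>\<^sup>2 * ((norm (q k - q l))\<^sup>2 - (norm (p k - p l))\<^sup>2)" for \<beta> k l
    by (simp add: A_def B_def norm_Pair power_mult_distrib right_diff_distrib flip: scaleR_diff_right)
  have term0: "0 \<le> s \<beta> t x k * s \<beta> t x l * ((norm (\<beta> *\<^sub>R B k - \<beta> *\<^sub>R B l))\<^sup>2 - (norm (\<beta> *\<^sub>R A k - \<beta> *\<^sub>R A l))\<^sup>2)"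
    if "k < N" "l < N" for \<beta> t x k l
    unfolding dist s_def using le2[OF that] by (intro mult_nonneg_nonneg softmax_nonneg) auto
  have f0: "0 \<le> f \<beta> t x" for \<beta> t x
    unfolding f_def by (intro mult_nonneg_nonneg sum_nonneg term0 bump_potential_nonneg) auto
  have fge: "s \<beta> t x j * s \<beta> t x i * (\<beta>\<^sup>2 * \<gamma>) * bump_potential x \<le> f \<beta> t x" for \<beta> t x
  proof -
    have "s \<beta> t x j * s \<beta> t x i * (\<beta>\<^sup>2 * \<gamma>) \<le> (\<Sum>l<N. s \<beta> t x j * s \<beta> t x l *
        ((norm (\<beta> *\<^sub>R B j - \<beta> *\<^sub>R B l))\<^sup>2 - (norm (\<beta> *\<^sub>R A j - \<beta> *\<^sub>R A l))\<^sup>2))"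
      unfolding \<gamma>_def Fz dist[symmetric]
      using ij by (intro member_le_sum[where f="\<lambda>l. s \<beta> t x j * s \<beta> t x l * _ l"] term0) auto
    also have "\<dots> \<le> (\<Sum>k<N. \<Sum>l<N. s \<beta> t x k * s \<beta> t x l *
        ((norm (\<beta> *\<^sub>R B k - \<beta> *\<^sub>R B l))\<^sup>2 - (norm (\<beta> *\<^sub>R A k - \<beta> *\<^sub>R A l))\<^sup>2))"
      using ij by (intro member_le_sum[where i=j and f="\<lambda>k. \<Sum>l<N. s \<beta> t x k * s \<beta> t x l *
        ((norm (\<beta> *\<^sub>R B k - \<beta> *\<^sub>R B l))\<^sup>2 - (norm (\<beta> *\<^sub>R A k - \<beta> *\<^sub>R A l))\<^sup>2)"] sum_nonneg term0) auto
    finally show ?thesis unfolding f_def by (intro mult_right_mono bump_potential_nonneg)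
  qed
  define \<mu> where "\<mu> = measure lborel (ball (0::'a\<times>'a) (\<rho>/4))"
  have \<mu>: "\<mu> > 0" unfolding \<mu>_def using \<rho> by (simp add: content_ball_pos)
  define \<eta> where "\<eta> = 1 / (real N * exp 1)"
  have \<eta>: "\<eta> > 0" using N by (simp add: \<eta>_def)
  \<comment> \<open>Two softmax weights at least \<open>\<eta>\<close>, the gain
    \<open>\<gamma>\<close> of the edge, \<open>bump_potential \<ge> 1/8\<close>, the slab volume up
    to \<open>1 / \<beta>\<close>, and finally \<open>sin t * cos t / 2 \<ge> 1/8\<close>.\<close>
  define c where "c = \<eta> * \<eta> * \<gamma> / 8 * (\<mu> / (4 * \<rho> * R)) / 8"
  have c: "c > 0" using \<eta> \<gamma> \<mu> \<rho> Rpos by (simp add: c_def)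
  have zij: "z j \<noteq> z i" using \<gamma> by (auto simp: \<gamma>_def F_def)
  \<comment> \<open>From here on the slab of half-width \<open>1 / \<beta>\<close> is thin enough
    for \<open>measure_slab_ball_ge\<close>, since the moving edge keeps at least half of its
    length.\<close>
  define \<beta>0 where "\<beta>0 = 8 / (\<rho> * norm (z j - z i))"
  have \<beta>0: "\<beta>0 > 0" using \<rho> zij by (simp add: \<beta>0_def)
  have lower: "\<beta> * c \<le> sin t * cos t / 2 * integral\<^sup>L lborel (f \<beta> t)"
    if t: "pi/6 \<le> t" "t \<le> pi/3" and \<beta>: "\<beta> \<ge> \<beta>0" for \<beta> t
  proof -
    define v where "v = Z t j - Z t i"
    define T where "T = ball (G t) \<rho> \<inter> {x. \<bar>v \<bullet> x\<bar> \<le> 1/\<beta>}"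
    have \<beta>pos: "\<beta> > 0" using \<beta> \<beta>0 by simp
    have nv: "norm v \<le> R" "norm (z j - z i) / 2 \<le> norm v"
      using order.trans[OF Zd R[OF ij(2) ij(1)]] Zd2[OF t] by (auto simp: v_def)
    have v0: "v \<noteq> 0" using nv zij by auto
    have sl: "1/\<beta> * \<mu> \<le> 4 * \<rho> * norm v * measure lborel T"
      unfolding \<mu>_def T_def
    proof (rule measure_slab_ball_ge[OF v0 _ \<rho>(1)])
      show "v \<bullet> G t = 0" by (simp add: v_def inner_diff_left ZG[OF t] gij)
      have "1 / \<beta> \<le> 1 / \<beta>0" using \<beta> \<beta>0 by (intro divide_left_mono) auto
      also have "\<dots> = \<rho> * (norm (z j - z i) / 2) / 4" by (simp add: \<beta>0_def)
      also have "\<dots> \<le> \<rho> * norm v / 4" using nv \<rho> by (intro divide_right_mono mult_left_mono) auto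
      finally show "1 / \<beta> \<le> \<rho> * norm v / 4" .
    qed (use \<beta>pos in simp)
    also have "\<dots> \<le> 4 * \<rho> * R * measure lborel T"
      using nv \<rho> by (intro mult_right_mono mult_left_mono) auto
    finally have mT: "\<mu> / (4 * \<rho> * R) \<le> \<beta> * measure lborel T"
      using \<rho> Rpos \<beta>pos by (simp add: field_simps)
    have fT: "\<eta> * \<eta> * (\<beta>\<^sup>2 * \<gamma>) * (1/8) \<le> f \<beta> t x" if x: "x \<in> T" for x
    proof -
      have xG: "norm (x - G t) < \<rho>" using x by (simp add: T_def dist_norm norm_minus_commute)
      have vx: "\<beta> * \<bar>v \<bullet> x\<bar> \<le> 1" using x \<beta>pos by (simp add: T_def field_simps)
      have near: "\<beta> * (Z t k \<bullet> x) - \<beta> * (Z t i \<bullet> x) \<le> 1 \<and> \<beta> * (Z t k \<bullet> x) - \<beta> * (Z t j \<bullet> x) \<le> 1"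
        \<comment> \<open>Points off the edge are dominated by both ends. A point on the edge has a
          convex combination of the two end values, which differ by at most
          \<open>1 / \<beta>\<close> inside the slab.\<close>
        if k: "k < N" for k
      proof (cases "k \<in> I")
        case True
        have "Z t k \<bullet> x - Z t l \<bullet> x \<le> 0" if l: "l = i \<or> l = j" for l
        proof -
          have "Z t k \<bullet> x - Z t l \<bullet> x = (g \<bullet> z k - g \<bullet> z l) + (Z t k - Z t l) \<bullet> (x - G t)"
            by (simp add: inner_diff_left inner_diff_right ZG[OF t])
          also have "(Z t k - Z t l) \<bullet> (x - G t) \<le> norm (Z t k - Z t l) * norm (x - G t)"
            by (rule norm_cauchy_schwarz)
          also have "\<dots> \<le> R * \<rho>"
            using order.trans[OF Zd R[of k l]] k l ij xG Rpos by (intro mult_mono) auto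
          also have "g \<bullet> z k - g \<bullet> z l + R * \<rho> \<le> 0" using \<delta>(2)[OF True] l gij \<rho>(3) by auto
          finally show ?thesis by simp
        qed
        then have "\<beta> * (Z t k \<bullet> x - Z t i \<bullet> x) \<le> 0" "\<beta> * (Z t k \<bullet> x - Z t j \<bullet> x) \<le> 0"
          using \<beta>pos by (simp_all add: mult_nonneg_nonpos)
        then show ?thesis by (simp add: right_diff_distrib)
      next
        case False
        then have "z k \<in> closed_segment (z i) (z j)" using k by (simp add: I_def)
        then obtain u where u: "0 \<le> u" "u \<le> 1" "z k = (1 - u) *\<^sub>R z i + u *\<^sub>R z j"
          by (auto simp: in_segment)
        have Zk: "Z t k = (1 - u) *\<^sub>R Z t i + u *\<^sub>R Z t j"
          using u(3) by (simp add: Z z_def scaleR_add_right mult.commute)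
        have e: "Z t k \<bullet> x - Z t i \<bullet> x = u * (v \<bullet> x)" "Z t k \<bullet> x - Z t j \<bullet> x = (1 - u) * (- (v \<bullet> x))"
          unfolding Zk v_def by (simp_all add: inner_add_left inner_diff_left algebra_simps)
        have b: "a * y \<le> \<bar>v \<bullet> x\<bar>" if "0 \<le> a" "a \<le> 1" "\<bar>y\<bar> = \<bar>v \<bullet> x\<bar>" for a y :: real
        proof -
          have "a * y \<le> a * \<bar>y\<bar>" using that by (intro mult_left_mono) auto
          also have "\<dots> \<le> 1 * \<bar>y\<bar>" using that by (intro mult_right_mono) auto
          finally show ?thesis using that by simp
        qed
        have "\<beta> * (Z t k \<bullet> x - Z t i \<bullet> x) \<le> \<beta> * \<bar>v \<bullet> x\<bar>" "\<beta> * (Z t k \<bullet> x - Z t j \<bullet> x) \<le> \<beta> * \<bar>v \<bullet> x\<bar>"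
          unfolding e using \<beta>pos u by (intro mult_left_mono b; simp)+
        with vx show ?thesis by (simp add: right_diff_distrib)
      qed
      have si: "\<eta> \<le> s \<beta> t x i" and sj: "\<eta> \<le> s \<beta> t x j"
        unfolding \<eta>_def s_def rot using near by (auto intro!: softmax_ge N)
      have "norm x \<le> 1/2"
        using norm_triangle_ineq[of "x - G t" "G t"] xG nG[OF t] \<rho>(2) by simp
      then have "x \<bullet> x \<le> (1/2)\<^sup>2" unfolding power2_norm_eq_inner[symmetric] by (intro power_mono) auto
      then have "(3/4)\<^sup>2 \<le> (max 0 (1 - x \<bullet> x))\<^sup>2" by (intro power_mono) (auto simp: power2_eq_square)
      then have "1/8 \<le> bump_potential x" by (simp add: bump_potential_def power2_eq_square)
      then have "\<eta> * \<eta> * (\<beta>\<^sup>2 * \<gamma>) * (1/8) \<le> s \<beta> t x j * s \<beta> t x i * (\<beta>\<^sup>2 * \<gamma>) * bump_potential x"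
        using si sj \<eta> \<gamma> by (intro mult_mono mult_nonneg_nonneg) auto
      also have "\<dots> \<le> f \<beta> t x" by (rule fge)
      finally show ?thesis .
    qed
    have "\<eta> * \<eta> * (\<beta>\<^sup>2 * \<gamma>) * (1/8) * measure lborel T \<le> integral\<^sup>L lborel (f \<beta> t)"
    proof (rule integral_ge_measure[OF intf f0 _ _ fT])
      show "T \<in> sets lborel" unfolding T_def by measurable
      show "bounded T" unfolding T_def by (rule bounded_subset[OF bounded_ball]) auto
    qed
    \<comment> \<open>One factor \<open>\<beta>\<close> compensates the shrinking slab. The other
      remains and yields the linear growth.\<close>
    moreover have "\<eta> * \<eta> * (\<beta>\<^sup>2 * \<gamma>) * (1/8) * measure lborel T =
        \<beta> * (\<eta> * \<eta> * \<gamma> / 8) * (\<beta> * measure lborel T)"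
      by (simp add: power2_eq_square)
    moreover have "\<beta> * (\<eta> * \<eta> * \<gamma> / 8) * (\<mu> / (4 * \<rho> * R)) \<le> \<beta> * (\<eta> * \<eta> * \<gamma> / 8) * (\<beta> * measure lborel T)"
      using \<beta>pos \<eta> \<gamma> by (intro mult_left_mono[OF mT]) auto
    moreover have "\<beta> * (\<eta> * \<eta> * \<gamma> / 8) * (\<mu> / (4 * \<rho> * R)) = 8 * (\<beta> * c)" by (simp add: c_def mult_ac)
    ultimately have I: "8 * (\<beta> * c) \<le> integral\<^sup>L lborel (f \<beta> t)" by linarith
    have "(1/2) * (1/2) \<le> sin t * cos t" using cos_sin_ge_half[OF t] by (intro mult_mono) auto
    then have "(1/8) * (8 * (\<beta> * c)) \<le> sin t * cos t / 2 * integral\<^sup>L lborel (f \<beta> t)"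
      using I c \<beta>pos by (intro mult_mono) auto
    then show ?thesis by simp
  qed
  have mono: "J \<beta> t1 \<le> J \<beta> t2" if "0 \<le> t1" "t1 \<le> t2" "t2 \<le> pi/2" for \<beta> t1 t2
  proof (rule DERIV_nonneg_imp_nondecreasing[OF that(2)])
    fix t assume "t1 \<le> t" "t \<le> t2"
    then have "sin t \<ge> 0" "cos t \<ge> 0" using that by (auto intro!: sin_ge_zero cos_ge_zero)
    then have "0 \<le> sin t * cos t / 2 * integral\<^sup>L lborel (f \<beta> t)"
      by (intro mult_nonneg_nonneg divide_nonneg_nonneg Bochner_Integration.integral_nonneg f0) auto
    with J show "\<exists>y. (J \<beta> has_real_derivative y) (at t) \<and> 0 \<le> y" by blast
  qed
  have gain: "\<beta> * c * (pi/6) \<le> J \<beta> (pi/2) - J \<beta> 0" if \<beta>: "\<beta> \<ge> \<beta>0" for \<beta>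
  proof -
    have "J \<beta> (pi/6) - \<beta> * c * (pi/6) \<le> J \<beta> (pi/3) - \<beta> * c * (pi/3)"
    proof (rule DERIV_nonneg_imp_nondecreasing[where f="\<lambda>t. J \<beta> t - \<beta> * c * t"])
      fix t assume t: "pi/6 \<le> t" "t \<le> pi/3"
      have "((\<lambda>t. J \<beta> t - \<beta> * c * t) has_real_derivative
          sin t * cos t / 2 * integral\<^sup>L lborel (f \<beta> t) - \<beta> * c) (at t)"
        by (auto intro!: derivative_eq_intros J)
      with lower[OF t \<beta>] show "\<exists>y. ((\<lambda>t. J \<beta> t - \<beta> * c * t) has_real_derivative y) (at t) \<and> 0 \<le> y"
        by (intro exI conjI) auto
    qed simp
    moreover have "J \<beta> 0 \<le> J \<beta> (pi/6)" "J \<beta> (pi/3) \<le> J \<beta> (pi/2)" by (intro mono; simp)+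
    moreover have "\<beta> * c * (pi/3) = \<beta> * c * (pi/6) + \<beta> * c * (pi/6)" by simp
    ultimately show ?thesis by linarith
  qed
  define mp where "mp = (\<integral>z. Max ((\<lambda>k. p k \<bullet> fst z) ` {..<N}) * bump (z::'a\<times>'a) \<partial>lborel)"
  define mq where "mq = (\<integral>z. Max ((\<lambda>k. q k \<bullet> snd z) ` {..<N}) * bump (z::'a\<times>'a) \<partial>lborel)"
  define L where "L = ln (real N) * (\<integral>z. bump (z::'a\<times>'a) \<partial>lborel)"
  have ne: "{..<N} \<noteq> {}" using N by (auto simp: lessThan_empty_iff)
  have Mb: "Max ((\<lambda>k. \<beta> * a k) ` {..<N}) = \<beta> * Max (a ` {..<N})" if "\<beta> > 0" for \<beta> and a :: "nat \<Rightarrow> real"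
    using mono_Max_commute[of "\<lambda>x. \<beta> * x" "a ` {..<N}"] that ne
    by (auto simp: mono_def image_image)
  have ip: "integrable lborel (\<lambda>z::'a\<times>'a. Max ((\<lambda>k. p k \<bullet> fst z) ` {..<N}) * bump z)"
    and iq: "integrable lborel (\<lambda>z::'a\<times>'a. Max ((\<lambda>k. q k \<bullet> snd z) ` {..<N}) * bump z)"
    and ib: "integrable lborel (bump :: 'a\<times>'a \<Rightarrow> real)"
    using ne by (auto intro!: integrable_lborel_bounded_support[where r=1] continuous_intros
      continuous_on_bump continuous_on_Max_image simp: bump_eq_0)
  have iJ: "integrable lborel (\<lambda>x. log_sum_exp N (\<lambda>k. \<beta> * (Z t k \<bullet> x)) * bump x)" for \<beta> t
    by (auto intro!: integrable_lborel_bounded_support[where r=1] continuous_intros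
      continuous_on_bump continuous_on_log_sum_exp N simp: bump_eq_0)
  \<comment> \<open>At this end the lower bound for log-sum-exp suffices, and it has no error term.
    Only the end at \<open>pi/2\<close> contributes \<open>L\<close>.\<close>
  have J0: "\<beta> * mp \<le> J \<beta> 0" if \<beta>: "\<beta> > 0" for \<beta>
  proof -
    have "\<beta> * mp = (\<integral>z. \<beta> * (Max ((\<lambda>k. p k \<bullet> fst z) ` {..<N}) * bump (z::'a\<times>'a)) \<partial>lborel)"
      by (simp add: mp_def)
    also have "\<dots> \<le> J \<beta> 0" unfolding J_def rot
    proof (intro integral_mono iJ Bochner_Integration.integrable_mult_right ip)
      fix x :: "'a \<times> 'a"
      have "\<beta> * Max ((\<lambda>k. p k \<bullet> fst x) ` {..<N}) \<le> log_sum_exp N (\<lambda>k. \<beta> * (Z 0 k \<bullet> x))"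
        using log_sum_exp_bounds(1)[OF N, of "\<lambda>k. \<beta> * (p k \<bullet> fst x)"] Mb[OF \<beta>]
        by (simp add: Z inner_prod_def)
      from mult_right_mono[OF this bump_nonneg]
      show "\<beta> * (Max ((\<lambda>k. p k \<bullet> fst x) ` {..<N}) * bump x) \<le> log_sum_exp N (\<lambda>k. \<beta> * (Z 0 k \<bullet> x)) * bump x"
        by (simp add: mult.assoc)
    qed
    finally show ?thesis .
  qed
  have J1: "J \<beta> (pi/2) \<le> \<beta> * mq + L" if \<beta>: "\<beta> > 0" for \<beta>
  proof -
    have "J \<beta> (pi/2) \<le> (\<integral>z. \<beta> * (Max ((\<lambda>k. q k \<bullet> snd z) ` {..<N}) * bump (z::'a\<times>'a)) + ln (real N) * bump z \<partial>lborel)"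
      unfolding J_def rot
    proof (intro integral_mono iJ Bochner_Integration.integrable_mult_right Bochner_Integration.integrable_add iq ib)
      fix x :: "'a \<times> 'a"
      have "log_sum_exp N (\<lambda>k. \<beta> * (Z (pi/2) k \<bullet> x)) \<le> \<beta> * Max ((\<lambda>k. q k \<bullet> snd x) ` {..<N}) + ln (real N)"
        using log_sum_exp_bounds(2)[OF N, of "\<lambda>k. \<beta> * (q k \<bullet> snd x)"] Mb[OF \<beta>]
        by (simp add: Z inner_prod_def)
      from mult_right_mono[OF this bump_nonneg]
      show "log_sum_exp N (\<lambda>k. \<beta> * (Z (pi/2) k \<bullet> x)) * bump x \<le>
          \<beta> * (Max ((\<lambda>k. q k \<bullet> snd x) ` {..<N}) * bump x) + ln (real N) * bump x"
        by (simp add: distrib_right mult.assoc)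
    qed
    also have "\<dots> = \<beta> * mq + L" using iq ib by (simp add: mq_def L_def)
    finally show ?thesis .
  qed
  \<comment> \<open>Large enough that the gain \<open>\<beta> * c * (pi/6)\<close> over the middle
    third of the path exceeds the smoothing error \<open>L\<close>.\<close>
  define \<beta> where "\<beta> = max \<beta>0 (L / (c * (pi/6)) + 1)"
  have \<beta>: "\<beta> \<ge> \<beta>0" "\<beta> > 0" using \<beta>0 by (auto simp: \<beta>_def)
  have cp: "c * (pi/6) > 0" using c by simp
  have "L / (c * (pi/6)) < \<beta>" by (simp add: \<beta>_def)
  then have "L < \<beta> * (c * (pi/6))" using cp by (simp only: pos_divide_less_eq)
  then have "\<beta> * mp < \<beta> * mq"
    using gain[OF \<beta>(1)] J0[OF \<beta>(2)] J1[OF \<beta>(2)] by (simp add: mult.assoc)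
  then show ?thesis using \<beta> by (simp add: mp_def mq_def)
qed


subsection \<open>Polar coordinates\<close>

lemma nn_integral_lborel_scaleR:
  fixes f :: "'a::euclidean_space \<Rightarrow> ennreal"
  assumes [measurable]: "f \<in> borel_measurable borel" and "c > 0"
  shows "(\<integral>\<^sup>+x. f x \<partial>lborel) = ennreal (c ^ DIM('a)) * (\<integral>\<^sup>+x. f (c *\<^sub>R x) \<partial>lborel)"
  using assms(2)
  by (subst lborel_affine[of c 0]) (simp_all add: nn_integral_density nn_integral_distr nn_integral_cmult)

lemma nn_integral_inverse_power_tail:
  assumes "a > 0" "n > 0"
  shows "(\<integral>\<^sup>+s. ennreal (real n * a ^ n * inverse s ^ Suc n) * indicator {a..} s \<partial>lborel) = 1"
proof -
  have "(\<integral>\<^sup>+s. ennreal (real n * a ^ n * inverse s ^ Suc n) * indicator {a..} s \<partial>lborel) =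
     ennreal (0 - (- ((a * inverse a) ^ n)))"
  proof (rule nn_integral_FTC_atLeast[where F="\<lambda>s. - ((a * inverse s) ^ n)"])
    fix s assume s: "a \<le> s"
    then have "s > 0" using assms by simp
    obtain m where m: "n = Suc m" using assms(2) gr0_implies_Suc by blast
    have "((\<lambda>s. a * inverse s) has_real_derivative - (a * (inverse s * inverse s))) (at s)"
      using \<open>s > 0\<close> by (auto intro!: derivative_eq_intros simp: power2_eq_square)
    from DERIV_minus[OF DERIV_power[OF this, of n]]
    show "((\<lambda>s. - ((a * inverse s) ^ n)) has_real_derivative real n * a ^ n * inverse s ^ Suc n) (at s)"
      by (rule DERIV_cong) (simp add: m power_mult_distrib algebra_simps)
    show "0 \<le> real n * a ^ n * inverse s ^ Suc n" using assms \<open>s > 0\<close> by simp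
  next
    have "((\<lambda>s::real. - ((a * inverse s) ^ n)) \<longlongrightarrow> - ((a * 0) ^ n)) at_top"
      by (intro tendsto_intros tendsto_inverse_0_at_top filterlim_ident)
    then show "((\<lambda>s::real. - ((a * inverse s) ^ n)) \<longlongrightarrow> 0) at_top" using assms by (simp add: zero_power)
  qed measurable
  then show ?thesis using assms by simp
qed

text \<open>The unit sphere is parametrised by the directions of the points of the unit ball. Inserting
  \<open>1 = (\<integral>\<^sup>+s\<in>{norm x..}. n * norm x ^ n / s ^ (n + 1))\<close> and exchanging the integrals reduces the formula to two
  linear substitutions.\<close>

lemma nn_integral_polar:
  fixes F :: "'a::euclidean_space \<Rightarrow> ennreal"
  assumes [measurable]: "F \<in> borel_measurable borel"
  shows "(\<integral>\<^sup>+x. F x \<partial>lborel) = (\<integral>\<^sup>+y. (\<integral>\<^sup>+r. ennreal (real DIM('a) * r ^ (DIM('a) - 1)) *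
     indicator {0<..} r * F (r *\<^sub>R sgn y) \<partial>lborel) * indicator (cball 0 1) y \<partial>lborel)"
proof -
  define n where "n = DIM('a)"
  have n: "n > 0" by (simp add: n_def)
  define K where "K = (\<lambda>s (x::'a). ennreal (real n * norm x ^ n * inverse s ^ Suc n) * indicator {norm x..} s)"
  have Kalt: "K s x = ennreal (real n * norm x ^ n * inverse s ^ Suc n) * (if norm x \<le> s then 1 else 0)" for s x
    by (simp add: K_def indicator_def)
  have [measurable]: "case_prod (\<lambda>s x. K s x * F x) \<in> borel_measurable (lborel \<Otimes>\<^sub>M lborel)"
    unfolding Kalt by measurable
  have [measurable]: "cball 0 1 \<in> sets (borel :: 'a measure)" by simp
  have nz: "AE x in lborel. (x::'a) \<noteq> 0" by (rule AE_lborel_singleton)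
  have "(\<integral>\<^sup>+x. F x \<partial>lborel) = (\<integral>\<^sup>+x. (\<integral>\<^sup>+s. K s x * F x \<partial>lborel) \<partial>lborel)"
  proof (rule nn_integral_cong_AE, use nz in eventually_elim)
    fix x :: 'a assume "x \<noteq> 0"
    then have "(\<integral>\<^sup>+s. K s x \<partial>lborel) = 1"
      unfolding K_def using n by (intro nn_integral_inverse_power_tail) auto
    moreover have "(\<integral>\<^sup>+s. K s x * F x \<partial>lborel) = (\<integral>\<^sup>+s. K s x \<partial>lborel) * F x"
      unfolding Kalt by (intro nn_integral_multc) measurable
    ultimately show "F x = (\<integral>\<^sup>+s. K s x * F x \<partial>lborel)" by simp
  qed
  also have "\<dots> = (\<integral>\<^sup>+s. (\<integral>\<^sup>+x. K s x * F x \<partial>lborel) \<partial>lborel)"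
    by (rule lborel_pair.Fubini') measurable
  also have "\<dots> = (\<integral>\<^sup>+s. (\<integral>\<^sup>+y. ennreal (real n * s ^ (n - 1) * norm y ^ n) * indicator {0<..} s *
     F (s *\<^sub>R y) * indicator (cball 0 1) (y::'a) \<partial>lborel) \<partial>lborel)"
  proof (rule nn_integral_cong)
    fix s :: real
    show "(\<integral>\<^sup>+x. K s x * F x \<partial>lborel) = (\<integral>\<^sup>+y. ennreal (real n * s ^ (n - 1) * norm y ^ n) * indicator {0<..} s *
     F (s *\<^sub>R y) * indicator (cball 0 1) (y::'a) \<partial>lborel)"
    proof (cases "s > 0")
      case True
      have [measurable]: "(\<lambda>x. K s x * F x) \<in> borel_measurable borel" unfolding Kalt by measurable
      obtain m where m: "n = Suc m" using n gr0_implies_Suc by blast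
      \<comment> \<open>First substitution, \<open>x = s *\<^sub>R y\<close>: the constraint
        \<open>norm x \<le> s\<close> becomes membership of \<open>y\<close> in the unit
        ball.\<close>
      have "(\<integral>\<^sup>+x. K s x * F x \<partial>lborel) = ennreal (s ^ n) * (\<integral>\<^sup>+y. K s (s *\<^sub>R y) * F (s *\<^sub>R y) \<partial>lborel)"
        unfolding n_def by (rule nn_integral_lborel_scaleR) (use True in measurable)
      also have "\<dots> = (\<integral>\<^sup>+y. ennreal (s ^ n) * (K s (s *\<^sub>R y) * F (s *\<^sub>R y)) \<partial>lborel)"
        by (rule nn_integral_cmult[symmetric]) measurable
      also have "\<dots> = (\<integral>\<^sup>+y. ennreal (real n * s ^ (n - 1) * norm y ^ n) * indicator {0<..} s *
         F (s *\<^sub>R y) * indicator (cball 0 1) (y::'a) \<partial>lborel)"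
      proof (rule nn_integral_cong)
        fix y :: 'a
        have e: "s ^ n * (real n * norm (s *\<^sub>R y) ^ n * inverse s ^ Suc n) = real n * s ^ (n - 1) * norm y ^ n"
          using True by (simp add: m power_mult_distrib field_simps)
        have "(norm (s *\<^sub>R y) \<le> s) = (y \<in> cball 0 1)" using True by (simp add: mult_le_cancel_left2)
        then have eK: "ennreal (s ^ n) * K s (s *\<^sub>R y) =
            ennreal (s ^ n * (real n * norm (s *\<^sub>R y) ^ n * inverse s ^ Suc n)) * indicator (cball 0 1) y"
          unfolding Kalt using True by (simp add: indicator_def ennreal_mult')
        show "ennreal (s ^ n) * (K s (s *\<^sub>R y) * F (s *\<^sub>R y)) = ennreal (real n * s ^ (n - 1) * norm y ^ n) *
            indicator {0<..} s * F (s *\<^sub>R y) * indicator (cball 0 1) y"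
          unfolding mult.assoc[of "ennreal (s ^ n)", symmetric] eK[unfolded e] using True by (simp add: mult_ac)
      qed
      finally show ?thesis .
    next
      case False
      \<comment> \<open>For negative \<open>s\<close> the indicator vanishes. At
        \<open>s = 0\<close> the default value \<open>inverse 0 = 0\<close> makes the kernel
        vanish.\<close>
      then have "K s x = 0" for x
        using n norm_ge_zero[of x] unfolding Kalt by (cases "s = 0") (auto simp del: norm_ge_zero)
      then show ?thesis using False by simp
    qed
  qed
  also have "\<dots> = (\<integral>\<^sup>+y. (\<integral>\<^sup>+s. ennreal (real n * s ^ (n - 1) * norm y ^ n) * indicator {0<..} s *
     F (s *\<^sub>R y) * indicator (cball 0 1) (y::'a) \<partial>lborel) \<partial>lborel)"
    by (rule lborel_pair.Fubini') measurable
  also have "\<dots> = (\<integral>\<^sup>+y. (\<integral>\<^sup>+r. ennreal (real n * r ^ (n - 1)) *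
     indicator {0<..} r * F (r *\<^sub>R sgn y) \<partial>lborel) * indicator (cball 0 1) y \<partial>lborel)"
  proof (rule nn_integral_cong_AE, use nz in eventually_elim)
    fix y :: 'a assume y: "y \<noteq> 0"
    obtain m where m: "n = Suc m" using n gr0_implies_Suc by blast
    \<comment> \<open>Second substitution, \<open>r = norm y * s\<close> for fixed \<open>y\<close>:
      it absorbs the factor \<open>norm y ^ n\<close>, and only the direction of \<open>y\<close> is
      left.\<close>
    have "(\<integral>\<^sup>+r. ennreal (real n * r ^ (n - 1)) * indicator {0<..} r * F (r *\<^sub>R sgn y) \<partial>lborel) =
      ennreal \<bar>norm y\<bar> * (\<integral>\<^sup>+s. ennreal (real n * (0 + norm y * s) ^ (n - 1)) * indicator {0<..} (0 + norm y * s) *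
        F ((0 + norm y * s) *\<^sub>R sgn y) \<partial>lborel)"
      by (rule nn_integral_real_affine) (use y in auto)
    also have "\<dots> = (\<integral>\<^sup>+s. ennreal (norm y) * (ennreal (real n * (norm y * s) ^ (n - 1)) * indicator {0<..} (norm y * s) *
        F ((norm y * s) *\<^sub>R sgn y)) \<partial>lborel)"
      by (simp add: nn_integral_cmult)
    also have "\<dots> = (\<integral>\<^sup>+s. ennreal (real n * s ^ (n - 1) * norm y ^ n) * indicator {0<..} s * F (s *\<^sub>R y) \<partial>lborel)"
    proof (rule nn_integral_cong)
      fix s :: real
      have "(norm y * s) *\<^sub>R sgn y = s *\<^sub>R y" using y by (simp add: sgn_div_norm)
      moreover have "indicator {0<..} (norm y * s) = (indicator {0<..} s :: ennreal)"
        using y by (simp add: indicator_def zero_less_mult_iff)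
      moreover have "norm y * (real n * (norm y * s) ^ (n - 1)) = real n * s ^ (n - 1) * norm y ^ n"
        by (simp add: m power_mult_distrib)
      then have "ennreal (norm y) * ennreal (real n * (norm y * s) ^ (n - 1)) = ennreal (real n * s ^ (n - 1) * norm y ^ n)"
        by (metis ennreal_mult' norm_ge_zero)
      ultimately show "ennreal (norm y) * (ennreal (real n * (norm y * s) ^ (n - 1)) * indicator {0<..} (norm y * s) *
        F ((norm y * s) *\<^sub>R sgn y)) = ennreal (real n * s ^ (n - 1) * norm y ^ n) * indicator {0<..} s * F (s *\<^sub>R y)"
        by (simp only: mult.assoc[symmetric])
    qed
    finally show "(\<integral>\<^sup>+s. ennreal (real n * s ^ (n - 1) * norm y ^ n) * indicator {0<..} s *
       F (s *\<^sub>R y) * indicator (cball 0 1) (y::'a) \<partial>lborel) = (\<integral>\<^sup>+r. ennreal (real n * r ^ (n - 1)) *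
       indicator {0<..} r * F (r *\<^sub>R sgn y) \<partial>lborel) * indicator (cball 0 1) y"
      by (simp add: nn_integral_multc)
  qed
  finally show ?thesis unfolding n_def .
qed

text \<open>In polar coordinates the radial integral of \<open>n * r ^ (n - 1)\<close> from 0 to
  \<open>\<rho> u\<close> is \<open>\<rho> u ^ n\<close>. Averaging over the ball in place of the
  sphere leaves no normalising constant.\<close>

lemma emeasure_star_shaped:
  fixes S :: "'a::euclidean_space set"
  assumes [measurable]: "S \<in> sets borel" and \<rho>: "\<And>u. \<rho> u \<ge> 0"
    and S: "\<And>u r. norm u = 1 \<Longrightarrow> r > 0 \<Longrightarrow> r *\<^sub>R u \<in> S \<longleftrightarrow> r \<le> \<rho> u"
  shows "emeasure lborel S = (\<integral>\<^sup>+y. ennreal (\<rho> (sgn y) ^ DIM('a)) * indicator (cball 0 1) y \<partial>lborel)"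
proof -
  have nz: "AE x in lborel. (x::'a) \<noteq> 0" by (rule AE_lborel_singleton)
  have "emeasure lborel S = (\<integral>\<^sup>+x. indicator S x \<partial>lborel)" by simp
  also have "\<dots> = (\<integral>\<^sup>+y. (\<integral>\<^sup>+r. ennreal (real DIM('a) * r ^ (DIM('a) - 1)) *
     indicator {0<..} r * indicator S (r *\<^sub>R sgn y) \<partial>lborel) * indicator (cball 0 1) y \<partial>lborel)"
    by (rule nn_integral_polar) measurable
  also have "\<dots> = (\<integral>\<^sup>+y. ennreal (\<rho> (sgn y) ^ DIM('a)) * indicator (cball 0 1) y \<partial>lborel)"
  proof (rule nn_integral_cong_AE, use nz in eventually_elim)
    fix y :: 'a assume y: "y \<noteq> 0"
    have n1: "norm (sgn y) = 1" using y by (simp add: norm_sgn)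
    have nz': "AE r in lborel. (r::real) \<noteq> 0" by (rule AE_lborel_singleton)
    have "(\<integral>\<^sup>+r. ennreal (real DIM('a) * r ^ (DIM('a) - 1)) * indicator {0<..} r * indicator S (r *\<^sub>R sgn y) \<partial>lborel) =
      (\<integral>\<^sup>+r. ennreal (real DIM('a) * r ^ (DIM('a) - 1)) * indicator {0..\<rho> (sgn y)} r \<partial>lborel)"
    proof (rule nn_integral_cong_AE, use nz' in eventually_elim)
      fix r :: real assume "r \<noteq> 0"
      then show "ennreal (real DIM('a) * r ^ (DIM('a) - 1)) * indicator {0<..} r * indicator S (r *\<^sub>R sgn y) =
        ennreal (real DIM('a) * r ^ (DIM('a) - 1)) * indicator {0..\<rho> (sgn y)} r"
        using S[OF n1, of r] by (auto simp: indicator_def)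
    qed
    also have "\<dots> = ennreal (\<rho> (sgn y) ^ DIM('a) - 0 ^ DIM('a))"
      using \<rho> by (intro nn_integral_FTC_Icc) (auto intro!: derivative_eq_intros)
    finally show "(\<integral>\<^sup>+r. ennreal (real DIM('a) * r ^ (DIM('a) - 1)) * indicator {0<..} r *
        indicator S (r *\<^sub>R sgn y) \<partial>lborel) * indicator (cball 0 1) y =
        ennreal (\<rho> (sgn y) ^ DIM('a)) * indicator (cball 0 1) y" by (simp add: zero_power)
  qed
  finally show ?thesis .
qed

lemma measure_star_shaped:
  fixes S :: "'a::euclidean_space set"
  assumes "S \<in> sets borel" "\<And>u. \<rho> u \<ge> 0" "\<rho> \<in> borel_measurable borel"
    and "\<And>u r. norm u = 1 \<Longrightarrow> r > 0 \<Longrightarrow> r *\<^sub>R u \<in> S \<longleftrightarrow> r \<le> \<rho> u"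
  shows "measure lborel S = (\<integral>y. indicator (cball 0 1) y * \<rho> (sgn y) ^ DIM('a) \<partial>lborel)"
proof -
  note assms(3)[measurable]
  have "emeasure lborel S = (\<integral>\<^sup>+y. ennreal (indicator (cball 0 1) y * \<rho> (sgn y) ^ DIM('a)) \<partial>lborel)"
    using emeasure_star_shaped[OF assms(1,2,4)]
    by (auto simp: indicator_def intro!: nn_integral_cong)
  then show ?thesis
    unfolding measure_def using assms(2)
    by (subst integral_eq_nn_integral) (measurable, auto)
qed


section \<open>Support functions of finite point sets and their integrals over directions\<close>

definition support :: "nat \<Rightarrow> (nat \<Rightarrow> 'a::real_inner) \<Rightarrow> 'a \<Rightarrow> real"
  where "support N p x = Max ((\<lambda>k. p k \<bullet> x) ` {..<N})"

lemma continuous_on_support: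
  fixes p :: "nat \<Rightarrow> 'a::euclidean_space"
  assumes "N \<ge> 1" shows "continuous_on A (support N p)"
  unfolding support_def[abs_def]
  using assms by (intro continuous_on_Max_image continuous_intros) (auto simp: lessThan_empty_iff)

lemma support_scaleR:
  assumes "N \<ge> 1" "r > 0" shows "support N p (r *\<^sub>R x) = r * support N p x"
proof -
  have "{..<N} \<noteq> {}" using assms by (auto simp: lessThan_empty_iff)
  then show ?thesis
    using mono_Max_commute[of "\<lambda>x. r * x" "(\<lambda>k. p k \<bullet> x) ` {..<N}"] assms
    by (auto simp: support_def mono_def image_image)
qed

lemma abs_support_le:
  assumes "N \<ge> 1" "\<And>k. k < N \<Longrightarrow> norm (p k) \<le> R"
  shows "\<bar>support N p x\<bar> \<le> R * norm x"
proof -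
  have ne: "{..<N} \<noteq> {}" using assms by (auto simp: lessThan_empty_iff)
  have "support N p x \<in> (\<lambda>k. p k \<bullet> x) ` {..<N}"
    unfolding support_def using ne by (intro Max_in) auto
  then obtain k where k: "k < N" "support N p x = p k \<bullet> x" by auto
  have "\<bar>p k \<bullet> x\<bar> \<le> norm (p k) * norm x" by (rule Cauchy_Schwarz_ineq2)
  also have "\<dots> \<le> R * norm x" using assms(2) k by (intro mult_right_mono) auto
  finally show ?thesis using k by simp
qed

text \<open>Integrating out the other factor leaves a radial weight
  \<open>\<omega> (norm x)\<close>. By homogeneity the radial and the angular parts separate, with a
  constant \<open>C\<close> that depends neither on \<open>f\<close> nor on the factor in which
  \<open>f\<close> is evaluated.\<close>

lemma nn_integral_homogeneous_bump:
  fixes f :: "'a::euclidean_space \<Rightarrow> real"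
  assumes [measurable]: "f \<in> borel_measurable borel" and f: "\<And>x. f x \<ge> 0"
    and hom: "\<And>r x. r > 0 \<Longrightarrow> f (r *\<^sub>R x) = r * f x"
  defines "\<omega> \<equiv> \<lambda>r. \<integral>\<^sup>+y. ennreal (max 0 (1 - r\<^sup>2 - (y::'a) \<bullet> y)) \<partial>lborel"
  defines "C \<equiv> \<integral>\<^sup>+r. ennreal (real DIM('a) * r ^ (DIM('a) - 1)) * indicator {0<..} r * (ennreal r * \<omega> r) \<partial>lborel"
  shows "(\<integral>\<^sup>+z. ennreal (f (fst z) * bump (z::'a\<times>'a)) \<partial>lborel) =
      C * (\<integral>\<^sup>+y. ennreal (f (sgn y)) * indicator (cball 0 1) y \<partial>lborel)" (is ?fst)
    and "(\<integral>\<^sup>+z. ennreal (f (snd z) * bump (z::'a\<times>'a)) \<partial>lborel) =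
      C * (\<integral>\<^sup>+y. ennreal (f (sgn y)) * indicator (cball 0 1) y \<partial>lborel)" (is ?snd)
proof -
  have [measurable]: "cball 0 1 \<in> sets (borel :: 'a measure)" by simp
  have [measurable]: "\<omega> \<in> borel_measurable borel" unfolding \<omega>_def by measurable
  have bump: "bump (x, y) = max 0 (1 - (norm x)\<^sup>2 - y \<bullet> y)" for x y :: 'a
    by (simp add: bump_def power2_norm_eq_inner diff_diff_eq)
  have [measurable]: "(bump :: 'a\<times>'a \<Rightarrow> real) \<in> borel_measurable borel"
    by (intro borel_measurable_continuous_onI continuous_on_bump)
  have [measurable]: "(fst :: 'a\<times>'a \<Rightarrow> 'a) \<in> borel_measurable borel" "(snd :: 'a\<times>'a \<Rightarrow> 'a) \<in> borel_measurable borel"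
    by (intro borel_measurable_continuous_onI continuous_intros)+
  have radial: "(\<integral>\<^sup>+x. ennreal (f x) * \<omega> (norm x) \<partial>lborel) =
      C * (\<integral>\<^sup>+y. ennreal (f (sgn y)) * indicator (cball 0 1) y \<partial>lborel)"
  proof -
    have "(\<integral>\<^sup>+x. ennreal (f x) * \<omega> (norm x) \<partial>lborel) =
      (\<integral>\<^sup>+y. (\<integral>\<^sup>+r. ennreal (real DIM('a) * r ^ (DIM('a) - 1)) * indicator {0<..} r *
        (ennreal (f (r *\<^sub>R sgn y)) * \<omega> (norm (r *\<^sub>R sgn y))) \<partial>lborel) * indicator (cball 0 1) y \<partial>lborel)"
      by (rule nn_integral_polar) measurable
    also have "\<dots> = (\<integral>\<^sup>+y. C * (ennreal (f (sgn y)) * indicator (cball 0 1) y) \<partial>lborel)"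
    proof (rule nn_integral_cong_AE, use AE_lborel_singleton[of "0::'a"] in eventually_elim)
      fix y :: 'a assume y: "y \<noteq> 0"
      have "(\<integral>\<^sup>+r. ennreal (real DIM('a) * r ^ (DIM('a) - 1)) * indicator {0<..} r *
        (ennreal (f (r *\<^sub>R sgn y)) * \<omega> (norm (r *\<^sub>R sgn y))) \<partial>lborel) =
        (\<integral>\<^sup>+r. ennreal (real DIM('a) * r ^ (DIM('a) - 1)) * indicator {0<..} r * (ennreal r * \<omega> r) * ennreal (f (sgn y)) \<partial>lborel)"
        using y f by (intro nn_integral_cong) (auto simp: indicator_def hom norm_sgn ennreal_mult' mult_ac)
      also have "\<dots> = C * ennreal (f (sgn y))"
        unfolding C_def by (rule nn_integral_multc) measurable
      finally show "(\<integral>\<^sup>+r. ennreal (real DIM('a) * r ^ (DIM('a) - 1)) * indicator {0<..} r *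
        (ennreal (f (r *\<^sub>R sgn y)) * \<omega> (norm (r *\<^sub>R sgn y))) \<partial>lborel) * indicator (cball 0 1) y =
        C * (ennreal (f (sgn y)) * indicator (cball 0 1) y)" by (simp add: mult.assoc)
    qed
    also have "\<dots> = C * (\<integral>\<^sup>+y. ennreal (f (sgn y)) * indicator (cball 0 1) y \<partial>lborel)"
      by (rule nn_integral_cmult) measurable
    finally show ?thesis .
  qed
  have inner: "(\<integral>\<^sup>+y. ennreal (f x * bump (x, y::'a)) \<partial>lborel) = ennreal (f x) * \<omega> (norm x)" for x
    unfolding \<omega>_def bump using f by (simp add: ennreal_mult' nn_integral_cmult)
  have "(\<integral>\<^sup>+z. ennreal (f (fst z) * bump (z::'a\<times>'a)) \<partial>lborel) =
      (\<integral>\<^sup>+x. (\<integral>\<^sup>+y. ennreal (f x * bump (x, y::'a)) \<partial>lborel) \<partial>lborel)"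
    unfolding lborel_prod[symmetric]
    by (subst lborel.nn_integral_fst[symmetric]) (simp_all add: lborel_prod)
  then show ?fst unfolding inner radial .
  \<comment> \<open>Rotation invariance of the weight is used here for the swap of the two
    factors.\<close>
  have sym: "bump (x, y) = bump (y, x)" for x y :: 'a by (simp add: bump_def add.commute)
  have "(\<integral>\<^sup>+z. ennreal (f (snd z) * bump (z::'a\<times>'a)) \<partial>lborel) =
      (\<integral>\<^sup>+y. (\<integral>\<^sup>+x. ennreal (f y * bump (x::'a, y)) \<partial>lborel) \<partial>lborel)"
    unfolding lborel_prod[symmetric]
    by (subst lborel_pair.nn_integral_snd[symmetric]) (simp_all add: lborel_prod)
  also have "\<dots> = (\<integral>\<^sup>+y. (\<integral>\<^sup>+x. ennreal (f y * bump (y, x::'a)) \<partial>lborel) \<partial>lborel)"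
    by (subst sym) (rule refl)
  finally show ?snd unfolding inner radial .
qed

lemma integrable_cball_bounded:
  fixes f :: "'a::euclidean_space \<Rightarrow> real"
  assumes [measurable]: "f \<in> borel_measurable borel" and "\<And>x. norm x \<le> 1 \<Longrightarrow> \<bar>f x\<bar> \<le> K"
  shows "integrable lborel (\<lambda>y. indicator (cball 0 1) y * f (sgn y))"
proof (rule Bochner_Integration.integrable_bound)
  have [measurable]: "cball 0 1 \<in> sets (borel :: 'a measure)" by simp
  show "integrable lborel (\<lambda>y::'a. K * indicator (cball 0 1) y)"
    by (intro Bochner_Integration.integrable_mult_right integrable_real_indicator)
       (use emeasure_lborel_cball_finite[of "0::'a" 1] in auto)
  show "(\<lambda>y. indicator (cball 0 1) y * f (sgn y)) \<in> borel_measurable lborel" by measurable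
  have "\<bar>f (sgn y)\<bar> \<le> K" for y using assms(2)[of "sgn y"] by (simp add: norm_sgn)
  then show "AE y in lborel. norm (indicator (cball 0 1) y * f (sgn y)) \<le> norm (K * indicator (cball 0 1) (y::'a))"
    by (intro always_eventually) (auto simp: indicator_def intro: order_trans[OF _ abs_ge_self])
qed

text \<open>Transfers the strict inequality from the weighted integrals over the doubled space to
  the mean over directions of the original space.\<close>

lemma integral_support_strict_mono:
  fixes p q :: "nat \<Rightarrow> 'a::euclidean_space"
  assumes N: "N \<ge> 1"
    and le: "\<And>i j. i < N \<Longrightarrow> j < N \<Longrightarrow> norm (p i - p j) \<le> norm (q i - q j)"
    and strict: "i0 < N" "j0 < N" "norm (p i0 - p j0) < norm (q i0 - q j0)"
  shows "(\<integral>y. indicator (cball 0 1) y * support N p (sgn y) \<partial>lborel) <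
    (\<integral>y. indicator (cball 0 1) y * support N q (sgn y) \<partial>lborel)"
proof -
  define R where "R = (\<Sum>k<N. norm (p k)) + (\<Sum>k<N. norm (q k))"
  have Rp: "norm (p k) \<le> R" and Rq: "norm (q k) \<le> R" if "k < N" for k
  proof -
    have "norm (p k) \<le> (\<Sum>k<N. norm (p k))" "norm (q k) \<le> (\<Sum>k<N. norm (q k))"
      using that by (auto intro!: member_le_sum)
    moreover have "(\<Sum>k<N. norm (p k)) \<ge> 0" "(\<Sum>k<N. norm (q k)) \<ge> 0" by (simp_all add: sum_nonneg)
    ultimately show "norm (p k) \<le> R" "norm (q k) \<le> R" by (auto simp: R_def)
  qed
  have R0: "R \<ge> 0" unfolding R_def by (intro add_nonneg_nonneg sum_nonneg) auto
  \<comment> \<open>A support function may be negative, while the separation of variables is stated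
    for nonnegative functions. The added term is homogeneous and contributes equally to both sides,
    so it cancels.\<close>
  define g where "g = (\<lambda>p (x::'a). support N p x + R * norm x)"
  have sm: "support N p' \<in> borel_measurable borel" for p' :: "nat \<Rightarrow> 'a"
    by (intro borel_measurable_continuous_onI continuous_on_support N)
  have gc: "continuous_on UNIV (g p')" for p' unfolding g_def by (intro continuous_intros continuous_on_support N)
  have gm: "g p' \<in> borel_measurable borel" for p'
    by (intro borel_measurable_continuous_onI gc)
  have gh: "g p' (r *\<^sub>R x) = r * g p' x" if "r > 0" for p' r x
    using that by (simp add: g_def support_scaleR[OF N that] algebra_simps)
  have sp: "\<bar>support N p x\<bar> \<le> R * norm x" and sq: "\<bar>support N q x\<bar> \<le> R * norm x" for x
    using Rp Rq by (auto intro!: abs_support_le[OF N])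
  have g0: "g p x \<ge> 0" "g q x \<ge> 0" for x
    using sp[of x] sq[of x] by (auto simp: g_def)
  have gi: "integrable lborel (\<lambda>y. indicator (cball 0 1) y * g p (sgn y))"
    "integrable lborel (\<lambda>y. indicator (cball 0 1) y * g q (sgn y))"
  proof -
    have "R * norm x \<le> R" if "norm x \<le> 1" for x :: 'a using R0 that by (simp add: mult_left_le)
    then have gb: "\<bar>g p x\<bar> \<le> 2 * R" "\<bar>g q x\<bar> \<le> 2 * R" if "norm x \<le> 1" for x
      using sp[of x] sq[of x] that g0[of x] by (force simp: g_def)+
    show "integrable lborel (\<lambda>y. indicator (cball 0 1) y * g p (sgn y))"
      by (rule integrable_cball_bounded[OF gm gb(1)])
    show "integrable lborel (\<lambda>y. indicator (cball 0 1) y * g q (sgn y))"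
      by (rule integrable_cball_bounded[OF gm gb(2)])
  qed
  define C where "C = (\<integral>\<^sup>+r. ennreal (real DIM('a) * r ^ (DIM('a) - 1)) * indicator {0<..} r *
    (ennreal r * (\<integral>\<^sup>+y. ennreal (max 0 (1 - r\<^sup>2 - (y::'a) \<bullet> y)) \<partial>lborel)) \<partial>lborel)"
  have Cp: "(\<integral>\<^sup>+z. ennreal (g p (fst z) * bump (z::'a\<times>'a)) \<partial>lborel) =
      C * (\<integral>\<^sup>+y. ennreal (g p (sgn y)) * indicator (cball 0 1) y \<partial>lborel)"
    unfolding C_def by (rule nn_integral_homogeneous_bump(1)[OF gm g0(1) gh])
  have Cq: "(\<integral>\<^sup>+z. ennreal (g q (snd z) * bump (z::'a\<times>'a)) \<partial>lborel) =
      C * (\<integral>\<^sup>+y. ennreal (g q (sgn y)) * indicator (cball 0 1) y \<partial>lborel)"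
    unfolding C_def by (rule nn_integral_homogeneous_bump(2)[OF gm g0(2) gh])
  have Cn: "(\<integral>\<^sup>+z. ennreal (norm (fst z) * bump (z::'a\<times>'a)) \<partial>lborel) =
     (\<integral>\<^sup>+z. ennreal (norm (snd z) * bump (z::'a\<times>'a)) \<partial>lborel)"
    by (subst nn_integral_homogeneous_bump(1), simp_all, subst nn_integral_homogeneous_bump(2), simp_all)
  have ib: "integrable lborel (\<lambda>z::'a\<times>'a. F z * bump z)" if "continuous_on UNIV F" for F
    using that by (intro integrable_lborel_bounded_support[where r=1] continuous_intros continuous_on_bump)
      (auto simp: bump_eq_0)
  have c1: "continuous_on UNIV (\<lambda>z::'a\<times>'a. support N p (fst z))" "continuous_on UNIV (\<lambda>z::'a\<times>'a. support N q (snd z))"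
    by (auto intro!: continuous_on_compose2[OF continuous_on_support[OF N, of UNIV]] continuous_intros)
  have nn: "(\<integral>z. norm (fst z) * bump (z::'a\<times>'a) \<partial>lborel) = (\<integral>z. norm (snd z) * bump (z::'a\<times>'a) \<partial>lborel)"
  proof -
    have "continuous_on UNIV (\<lambda>z::'a\<times>'a. norm (fst z))" "continuous_on UNIV (\<lambda>z::'a\<times>'a. norm (snd z))"
      by (intro continuous_intros)+
    from this[THEN ib] show ?thesis
      using Cn by (subst (1 2) integral_eq_nn_integral) (auto simp: bump_nonneg)
  qed
  have "(\<integral>z. g p (fst z) * bump (z::'a\<times>'a) \<partial>lborel) < (\<integral>z. g q (snd z) * bump (z::'a\<times>'a) \<partial>lborel)"
  proof -
    have "(\<integral>z. g p (fst z) * bump (z::'a\<times>'a) \<partial>lborel) =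
      (\<integral>z. support N p (fst z) * bump (z::'a\<times>'a) \<partial>lborel) + R * (\<integral>z. norm (fst z) * bump (z::'a\<times>'a) \<partial>lborel)"
      using ib[OF c1(1)] ib[of "\<lambda>z. norm (fst z)"] by (simp add: g_def distrib_right mult.assoc continuous_intros)
    moreover have "(\<integral>z. g q (snd z) * bump (z::'a\<times>'a) \<partial>lborel) =
      (\<integral>z. support N q (snd z) * bump (z::'a\<times>'a) \<partial>lborel) + R * (\<integral>z. norm (snd z) * bump (z::'a\<times>'a) \<partial>lborel)"
      using ib[OF c1(2)] ib[of "\<lambda>z. norm (snd z)"] by (simp add: g_def distrib_right mult.assoc continuous_intros)
    ultimately show ?thesis
      using integral_Max_inner_strict_mono[OF N le strict] nn unfolding support_def by simp
  qed
  moreover have "integrable lborel (\<lambda>z::'a\<times>'a. g p (fst z) * bump z)" "integrable lborel (\<lambda>z::'a\<times>'a. g q (snd z) * bump z)"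
    by (auto intro!: ib continuous_on_compose2[OF gc] continuous_intros)
  ultimately have "(\<integral>\<^sup>+z. ennreal (g p (fst z) * bump (z::'a\<times>'a)) \<partial>lborel) < (\<integral>\<^sup>+z. ennreal (g q (snd z) * bump (z::'a\<times>'a)) \<partial>lborel)"
    by (subst (1 2) nn_integral_eq_integral)
       (auto simp: ennreal_less_iff g0 bump_nonneg intro!: Bochner_Integration.integral_nonneg)
  \<comment> \<open>The factor \<open>C\<close> cancels whatever its value: multiplication by it is
    monotone, so the reverse inequality here would contradict the strict one above.\<close>
  then have "(\<integral>\<^sup>+y. ennreal (g p (sgn y)) * indicator (cball 0 1) y \<partial>lborel) <
      (\<integral>\<^sup>+y. ennreal (g q (sgn y)) * indicator (cball 0 1) y \<partial>lborel)"
    unfolding Cp Cq by (metis linorder_not_le mult_left_mono zero_le)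
  moreover have conv: "(\<integral>\<^sup>+y. ennreal (g p' (sgn y)) * indicator (cball 0 1) y \<partial>lborel) =
      ennreal (\<integral>y. indicator (cball 0 1) y * g p' (sgn y) \<partial>lborel)" if "p' = p \<or> p' = q" for p'
  proof -
    have "(\<integral>\<^sup>+y. ennreal (g p' (sgn y)) * indicator (cball 0 1) y \<partial>lborel) =
       (\<integral>\<^sup>+y. ennreal (indicator (cball 0 1) y * g p' (sgn y)) \<partial>lborel)"
      by (intro nn_integral_cong) (auto simp: indicator_def)
    also have "\<dots> = ennreal (\<integral>y. indicator (cball 0 1) y * g p' (sgn y) \<partial>lborel)"
      using gi g0 that by (intro nn_integral_eq_integral) auto
    finally show ?thesis .
  qed
  ultimately have "(\<integral>y. indicator (cball 0 1) y * g p (sgn y) \<partial>lborel) < (\<integral>y. indicator (cball 0 1) y * g q (sgn y) \<partial>lborel)"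
    using g0 by (simp add: ennreal_less_iff)
  moreover have "(\<integral>y. indicator (cball 0 1) y * g p' (sgn y) \<partial>lborel) =
     (\<integral>y. indicator (cball 0 1) y * support N p' (sgn y) \<partial>lborel) + (\<integral>y. indicator (cball 0 1) y * (R * norm (sgn (y::'a))) \<partial>lborel)"
    if "p' = p \<or> p' = q" for p'
  proof -
    have "R * norm x \<le> R" if "norm x \<le> 1" for x :: 'a using R0 that by (simp add: mult_left_le)
    then have b: "\<bar>support N p' x\<bar> \<le> R" "\<bar>R * norm x\<bar> \<le> R" if "norm x \<le> 1" for x
      using sp[of x] sq[of x] that \<open>p' = p \<or> p' = q\<close> R0 by fastforce+
    have "integrable lborel (\<lambda>y. indicator (cball 0 1) y * support N p' (sgn y))"
      by (rule integrable_cball_bounded[OF sm b(1)])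
    moreover have "integrable lborel (\<lambda>y::'a. indicator (cball 0 1) y * (R * norm (sgn y)))"
      by (rule integrable_cball_bounded[OF _ b(2)]) measurable
    ultimately show ?thesis by (simp add: g_def distrib_left)
  qed
  ultimately show ?thesis by simp
qed


subsection \<open>Volumes of unions and intersections of large balls\<close>

text \<open>For a unit vector \<open>u\<close> and \<open>norm p \<le> r\<close> this is the larger
  root \<open>t\<close> of \<open>(norm (t *\<^sub>R u - p))\<^sup>2 = r\<^sup>2\<close>, the
  distance from the origin to the sphere in direction \<open>u\<close>.\<close>

definition ball_radial :: "'a::real_inner \<Rightarrow> real \<Rightarrow> 'a \<Rightarrow> real"
  where "ball_radial p r u = p \<bullet> u + sqrt (r\<^sup>2 - (norm p)\<^sup>2 + (p \<bullet> u)\<^sup>2)"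

lemma ball_radial_nonneg:
  assumes "norm p \<le> r" shows "0 \<le> ball_radial p r u"
proof -
  have "(norm p)\<^sup>2 \<le> r\<^sup>2" using assms by (intro power_mono) auto
  then have "sqrt ((p \<bullet> u)\<^sup>2) \<le> sqrt (r\<^sup>2 - (norm p)\<^sup>2 + (p \<bullet> u)\<^sup>2)" by (intro real_sqrt_le_mono) simp
  then show ?thesis unfolding ball_radial_def real_sqrt_abs by linarith
qed

text \<open>Completing the square puts \<open>t\<close> between two roots. The ball contains the
  origin, so the smaller root is not positive and only the upper bound restricts
  \<open>t > 0\<close>.\<close>

lemma scaleR_in_cball_iff:
  assumes "norm u = 1" "t > 0" "norm p \<le> r"
  shows "t *\<^sub>R u \<in> cball p r \<longleftrightarrow> t \<le> ball_radial p r u"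
proof -
  define s where "s = p \<bullet> u"
  have r: "r \<ge> 0" using assms(3) norm_ge_zero order_trans by blast
  have pr: "(norm p)\<^sup>2 \<le> r\<^sup>2" using assms(3) by (intro power_mono) auto
  have "t *\<^sub>R u \<in> cball p r \<longleftrightarrow> (norm (p - t *\<^sub>R u))\<^sup>2 \<le> r\<^sup>2"
    using r by (simp add: dist_norm abs_le_square_iff[symmetric])
  also have "(norm (p - t *\<^sub>R u))\<^sup>2 = (norm p)\<^sup>2 - 2 * t * s + t\<^sup>2"
  proof -
    have "u \<bullet> u = 1" using assms(1) by (simp add: dot_square_norm)
    then show ?thesis
      unfolding s_def power2_norm_eq_inner power2_eq_square[of t]
      by (simp add: inner_diff_left inner_diff_right inner_commute[of u p] algebra_simps)
  qed
  also have "(norm p)\<^sup>2 - 2 * t * s + t\<^sup>2 \<le> r\<^sup>2 \<longleftrightarrow> (t - s)\<^sup>2 \<le> r\<^sup>2 - (norm p)\<^sup>2 + s\<^sup>2"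
    by (auto simp: power2_diff algebra_simps)
  also have "\<dots> \<longleftrightarrow> \<bar>t - s\<bar> \<le> sqrt (r\<^sup>2 - (norm p)\<^sup>2 + s\<^sup>2)"
    using real_sqrt_le_iff[of "(t - s)\<^sup>2"] by simp
  also have "\<dots> \<longleftrightarrow> t \<le> s + sqrt (r\<^sup>2 - (norm p)\<^sup>2 + s\<^sup>2)"
  proof -
    have "\<bar>s\<bar> \<le> sqrt (r\<^sup>2 - (norm p)\<^sup>2 + s\<^sup>2)"
      using pr by (intro real_le_rsqrt) auto
    then show ?thesis using assms(2) by linarith
  qed
  finally show ?thesis by (simp add: ball_radial_def s_def)
qed

text \<open>With \<open>d = (norm p)\<^sup>2 - (p \<bullet> u)\<^sup>2\<close>, the root
  \<open>sqrt (r\<^sup>2 - d)\<close> lies between \<open>r - d / r\<close> and \<open>r\<close>.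
  The lower estimate squares to \<open>d \<le> r\<^sup>2\<close>.\<close>

lemma ball_radial_approx:
  assumes "norm u \<le> 1" "norm p \<le> r" "r > 0"
  shows "\<bar>ball_radial p r u - (p \<bullet> u + r)\<bar> \<le> (norm p)\<^sup>2 / r"
proof -
  define d where "d = (norm p)\<^sup>2 - (p \<bullet> u)\<^sup>2"
  have "\<bar>p \<bullet> u\<bar> \<le> norm p * norm u" by (rule Cauchy_Schwarz_ineq2)
  also have "\<dots> \<le> norm p" using assms(1) by (simp add: mult_left_le)
  finally have "\<bar>p \<bullet> u\<bar>\<^sup>2 \<le> (norm p)\<^sup>2" by (intro power_mono) auto
  then have d: "0 \<le> d" "d \<le> (norm p)\<^sup>2" by (simp_all add: d_def)
  have pr: "(norm p)\<^sup>2 \<le> r\<^sup>2" using assms(2) by (intro power_mono) auto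
  have "d / r \<le> r" using d pr assms(3) by (simp add: divide_le_eq power2_eq_square)
  have "(d / r)\<^sup>2 \<le> d"
  proof -
    have "(d / r)\<^sup>2 = d / r * d / r" by (simp add: power2_eq_square)
    also have "\<dots> = (d / r) * (d / r)" by simp
    also have "\<dots> \<le> r * (d / r)" using \<open>d / r \<le> r\<close> d assms(3) by (intro mult_right_mono) auto
    also have "\<dots> = d" using assms(3) by simp
    finally show ?thesis .
  qed
  then have "(r - d / r)\<^sup>2 \<le> r\<^sup>2 - d" using assms(3) by (simp add: power2_diff)
  then have lo: "r - d / r \<le> sqrt (r\<^sup>2 - d)" by (rule real_le_rsqrt)
  have hi: "sqrt (r\<^sup>2 - d) \<le> r" using d assms(3) by (intro real_le_lsqrt) auto
  have "d / r \<le> (norm p)\<^sup>2 / r" using d assms(3) by (simp add: divide_right_mono)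
  moreover have "ball_radial p r u = p \<bullet> u + sqrt (r\<^sup>2 - d)"
    by (simp add: ball_radial_def d_def algebra_simps)
  ultimately show ?thesis using lo hi by (auto simp: abs_le_iff)
qed

section \<open>Expansion of radial integrals for large radii\<close>

lemma abs_Max_diff_le:
  fixes a b :: "'i \<Rightarrow> real"
  assumes "finite I" "I \<noteq> {}" "\<And>i. i \<in> I \<Longrightarrow> \<bar>a i - b i\<bar> \<le> e"
  shows "\<bar>Max (a ` I) - Max (b ` I)\<bar> \<le> e"
proof -
  have "Max (f ` I) \<le> Max (g ` I) + e" if "\<And>i. i \<in> I \<Longrightarrow> f i \<le> g i + e" for f g :: "'i \<Rightarrow> real"
  proof -
    obtain i where "i \<in> I" "Max (f ` I) = f i" using Max_in[of "f ` I"] assms(1,2) by fastforce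
    moreover have "g i \<le> Max (g ` I)" using assms(1) \<open>i \<in> I\<close> by (intro Max_ge) auto
    ultimately show ?thesis using that[of i] by linarith
  qed
  from this[of a b] this[of b a] assms(3) show ?thesis by (force simp: abs_le_iff)
qed

lemma Min_eq_minus_Max:
  fixes a :: "'i \<Rightarrow> real"
  assumes "finite I" "I \<noteq> {}"
  shows "Min (a ` I) = - Max ((\<lambda>i. - a i) ` I)"
  using minus_Max_eq_Min[of "(\<lambda>i. - a i) ` I"] assms by (simp add: image_image)

text \<open>The quotient factors as \<open>(P - r) * (\<Sum>i<n. (P / r) ^ i)\<close>, where the
  first factor tends to \<open>h\<close> and each of the \<open>n\<close> summands to 1. Dominated
  convergence carries the limit through the integral.\<close>

lemma tendsto_integral_radial_power:
  fixes P :: "real \<Rightarrow> 'a::euclidean_space \<Rightarrow> real" and n :: nat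
  assumes Pm: "\<And>r. P r \<in> borel_measurable borel" and hm: "h \<in> borel_measurable borel"
    and K: "\<And>u. norm u \<le> 1 \<Longrightarrow> \<bar>h u\<bar> \<le> K"
    and P: "\<And>r u. r \<ge> rmin \<Longrightarrow> norm u \<le> 1 \<Longrightarrow> \<bar>P r u - (h u + r)\<bar> \<le> K / r"
  shows "((\<lambda>r. \<integral>y. indicator (cball 0 1) y * ((P r (sgn y) ^ n - r ^ n) / r ^ (n - 1)) \<partial>lborel) \<longlongrightarrow>
    real n * (\<integral>y. indicator (cball 0 1) y * h (sgn y) \<partial>lborel)) at_top"
proof -
  note Pm[measurable] hm[measurable]
  have [measurable]: "cball 0 1 \<in> sets (borel :: 'a measure)" by simp
  have K0: "K \<ge> 0" using K[of 0] by force
  \<comment> \<open>Dominating constant: for \<open>r \<ge> 1\<close> beyond \<open>rmin\<close> one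
    has \<open>\<bar>P - r\<bar> \<le> 2 * K\<close> and hence
    \<open>\<bar>P / r\<bar> \<le> 1 + 2 * K\<close>.\<close>
  define M where "M = 2 * K * (\<Sum>i<n. (1 + 2 * K) ^ i)"
  have M0: "M \<ge> 0" unfolding M_def using K0 by (intro mult_nonneg_nonneg sum_nonneg) auto
  have s1: "norm (sgn y) \<le> 1" for y :: 'a by (simp add: norm_sgn)
  have fac: "(x ^ n - r ^ n) / r ^ (n - 1) = (x - r) * (\<Sum>i<n. (x / r) ^ i)" if "r > 0" for x r :: real
  proof -
    have "r ^ (n - Suc i) * x ^ i / r ^ (n - 1) = (x / r) ^ i" if "i < n" for i
    proof -
      have "r ^ (n - 1) = r ^ (n - Suc i) * r ^ i" using that by (simp flip: power_add)
      then show ?thesis using \<open>r > 0\<close> by (simp add: power_divide)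
    qed
    then have "(\<Sum>i<n. r ^ (n - Suc i) * x ^ i) / r ^ (n - 1) = (\<Sum>i<n. (x / r) ^ i)"
      by (simp add: sum_divide_distrib)
    then show ?thesis unfolding power_diff_sumr2 by (simp only: times_divide_eq_right[symmetric])
  qed
  have lim: "((\<lambda>r. (P r u ^ n - r ^ n) / r ^ (n - 1)) \<longlongrightarrow> real n * h u) at_top" if u: "norm u \<le> 1" for u
  proof -
    have a: "((\<lambda>r. P r u - r) \<longlongrightarrow> h u) at_top"
    proof -
      have "((\<lambda>r. P r u - (h u + r)) \<longlongrightarrow> 0) at_top"
      proof (rule Lim_null_comparison)
        show "\<forall>\<^sub>F r in at_top. norm (P r u - (h u + r)) \<le> K / r"
          using eventually_ge_at_top[of rmin] by eventually_elim (use P u in auto)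
        show "((\<lambda>r. K / r) \<longlongrightarrow> 0) at_top"
          by (intro tendsto_divide_0[OF tendsto_const] filterlim_at_top_imp_at_infinity filterlim_ident)
      qed
      from tendsto_add[OF this tendsto_const[of "h u"]] show ?thesis by simp
    qed
    have "((\<lambda>r. (P r u - r) * inverse r + 1) \<longlongrightarrow> h u * 0 + 1) at_top"
      by (intro tendsto_intros a tendsto_inverse_0_at_top filterlim_ident)
    then have b: "((\<lambda>r. P r u / r) \<longlongrightarrow> 1) at_top"
      by (rule Lim_transform_eventually[THEN tendsto_eq_rhs])
         (use eventually_gt_at_top[of 0] in eventually_elim, auto simp: field_simps)
    have "((\<lambda>r. (P r u - r) * (\<Sum>i<n. (P r u / r) ^ i)) \<longlongrightarrow> h u * (\<Sum>i<n. 1 ^ i)) at_top"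
      by (intro tendsto_intros a b)
    then show ?thesis
      by (rule Lim_transform_eventually[THEN tendsto_eq_rhs])
         (use eventually_gt_at_top[of 0] in \<open>eventually_elim, simp only: fac\<close>, simp)
  qed
  have "((\<lambda>r. \<integral>y. indicator (cball 0 1) y * ((P r (sgn y) ^ n - r ^ n) / r ^ (n - 1)) \<partial>lborel) \<longlongrightarrow>
    (\<integral>y. indicator (cball 0 1) y * (real n * h (sgn y)) \<partial>lborel)) at_top"
  proof (rule integral_dominated_convergence_at_top)
    show "integrable lborel (\<lambda>y::'a. M * indicator (cball 0 1) y)"
      by (intro Bochner_Integration.integrable_mult_right integrable_real_indicator)
         (use emeasure_lborel_cball_finite[of "0::'a" 1] in auto)
    show "AE y in lborel. ((\<lambda>r. indicator (cball 0 1) y * ((P r (sgn y) ^ n - r ^ n) / r ^ (n - 1))) \<longlongrightarrow>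
        indicator (cball 0 1) y * (real n * h (sgn y))) at_top"
      by (intro always_eventually allI tendsto_mult_left lim s1)
    show "\<forall>\<^sub>F r in at_top. AE y in lborel. norm (indicator (cball 0 1) y * ((P r (sgn y) ^ n - r ^ n) / r ^ (n - 1)))
        \<le> M * indicator (cball 0 1) (y::'a)"
      using eventually_ge_at_top[of "max 1 rmin"]
    proof eventually_elim
      case (elim r)
      have "norm ((P r u ^ n - r ^ n) / r ^ (n - 1)) \<le> M" if u: "norm u \<le> 1" for u
      proof -
        have "K / r \<le> K" using elim K0 by (simp add: divide_le_eq mult_left_le mult_ge1_I mult_le_cancel_left1)
        then have d: "\<bar>P r u - r\<bar> \<le> 2 * K" using P[of r u] K[OF u] elim u by (simp add: abs_le_iff)
        have "\<bar>P r u / r\<bar> \<le> 1 + 2 * K"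
        proof -
          have "\<bar>P r u\<bar> \<le> r + 2 * K" using d elim by (simp add: abs_le_iff)
          also have "\<dots> \<le> r + 2 * K * r" using elim K0 by (simp add: mult_le_cancel_left1)
          finally show ?thesis using elim by (simp add: divide_le_eq abs_divide algebra_simps)
        qed
        then have "\<bar>\<Sum>i<n. (P r u / r) ^ i\<bar> \<le> (\<Sum>i<n. (1 + 2 * K) ^ i)"
          by (intro order_trans[OF sum_abs] sum_mono) (simp add: power_abs power_mono)
        then have "\<bar>(P r u - r) * (\<Sum>i<n. (P r u / r) ^ i)\<bar> \<le> M"
          unfolding abs_mult M_def using d K0 by (intro mult_mono) auto
        then show ?thesis using elim by (subst fac) auto
      qed
      then show ?case using s1 by (intro always_eventually allI) (auto simp: indicator_def)
    qed
  qed measurable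
  then show ?thesis by (simp add: mult.left_commute)
qed

text \<open>The leading term \<open>r ^ n\<close> times the volume of the unit ball is common to
  both integrals, so for large \<open>r\<close> the comparison is decided by the next order, the
  integrals of \<open>h\<close> and \<open>g\<close>.\<close>

lemma eventually_integral_radial_power_less:
  fixes P Q :: "real \<Rightarrow> 'a::euclidean_space \<Rightarrow> real" and n :: nat
  assumes Pm: "\<And>r. P r \<in> borel_measurable borel" and hm: "h \<in> borel_measurable borel"
    and Qm: "\<And>r. Q r \<in> borel_measurable borel" and gm: "g \<in> borel_measurable borel"
    and h: "\<And>u. norm u \<le> 1 \<Longrightarrow> \<bar>h u\<bar> \<le> K" and g: "\<And>u. norm u \<le> 1 \<Longrightarrow> \<bar>g u\<bar> \<le> K"
    and P: "\<And>r u. r \<ge> rmin \<Longrightarrow> norm u \<le> 1 \<Longrightarrow> \<bar>P r u - (h u + r)\<bar> \<le> K / r"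
    and Q: "\<And>r u. r \<ge> rmin \<Longrightarrow> norm u \<le> 1 \<Longrightarrow> \<bar>Q r u - (g u + r)\<bar> \<le> K / r"
    and less: "(\<integral>y. indicator (cball 0 1) y * h (sgn y) \<partial>lborel) < (\<integral>y. indicator (cball 0 1) y * g (sgn y) \<partial>lborel)"
    and n: "n > 0"
  shows "\<forall>\<^sub>F r in at_top. (\<integral>y. indicator (cball 0 1) y * P r (sgn y) ^ n \<partial>lborel) <
    (\<integral>y. indicator (cball 0 1) y * Q r (sgn y) ^ n \<partial>lborel)"
proof -
  let ?I = "\<lambda>P r. \<integral>y. indicator (cball 0 1) y * ((P r (sgn y) ^ n - r ^ n) / r ^ (n - 1)) \<partial>lborel"
  have "((\<lambda>r. ?I Q r - ?I P r) \<longlongrightarrow> real n * (\<integral>y. indicator (cball 0 1) y * g (sgn y) \<partial>lborel) -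
      real n * (\<integral>y. indicator (cball 0 1) y * h (sgn y) \<partial>lborel)) at_top"
    by (intro tendsto_diff tendsto_integral_radial_power[OF Qm gm g Q] tendsto_integral_radial_power[OF Pm hm h P])
  moreover have "0 < real n * (\<integral>y. indicator (cball 0 1) y * g (sgn y) \<partial>lborel) -
      real n * (\<integral>y. indicator (cball 0 1) y * h (sgn y) \<partial>lborel)"
    using less n by simp
  ultimately have "\<forall>\<^sub>F r in at_top. 0 < ?I Q r - ?I P r" by (rule order_tendstoD(1))
  then show ?thesis using eventually_gt_at_top[of 0] eventually_ge_at_top[of rmin]
  proof eventually_elim
    case (elim r)
    have int: "integrable lborel (\<lambda>y. indicator (cball 0 1) y * F r (sgn y) ^ n)"
      and eq: "?I F r = ((\<integral>y. indicator (cball 0 1) y * F r (sgn y) ^ n \<partial>lborel) - r ^ n * (\<integral>y. indicator (cball 0 1) (y::'a) \<partial>lborel)) / r ^ (n - 1)"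
      if Fm: "F r \<in> borel_measurable borel" and F: "\<And>u. norm u \<le> 1 \<Longrightarrow> \<bar>F r u - (f u + r)\<bar> \<le> K / r" "\<And>u. norm u \<le> 1 \<Longrightarrow> \<bar>f u\<bar> \<le> K"
      for F :: "real \<Rightarrow> 'a \<Rightarrow> real" and f
    proof -
      have "\<bar>F r u ^ n\<bar> \<le> (K / r + K + r) ^ n" if u: "norm u \<le> 1" for u
        unfolding power_abs using F(1)[OF u] F(2)[OF u] elim by (intro power_mono) (auto simp: abs_le_iff)
      then show int: "integrable lborel (\<lambda>y. indicator (cball 0 1) y * F r (sgn y) ^ n)"
        using Fm by (intro integrable_cball_bounded[where f="\<lambda>u. F r u ^ n"]) auto
      have ci: "integrable lborel (indicator (cball 0 1) :: 'a \<Rightarrow> real)"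
        by (intro integrable_real_indicator) (use emeasure_lborel_cball_finite[of "0::'a" 1] in auto)
      have "?I F r = (\<integral>y. (indicator (cball 0 1) y * F r (sgn y) ^ n - r ^ n * indicator (cball 0 1) y) / r ^ (n - 1) \<partial>lborel)"
        by (intro Bochner_Integration.integral_cong) (auto simp: algebra_simps)
      also have "\<dots> = ((\<integral>y. indicator (cball 0 1) y * F r (sgn y) ^ n \<partial>lborel) - r ^ n * (\<integral>y. indicator (cball 0 1) (y::'a) \<partial>lborel)) / r ^ (n - 1)"
        using int ci by simp
      finally show "?I F r = \<dots>" .
    qed
    have "?I P r = ((\<integral>y. indicator (cball 0 1) y * P r (sgn y) ^ n \<partial>lborel) - r ^ n * (\<integral>y. indicator (cball 0 1) (y::'a) \<partial>lborel)) / r ^ (n - 1)"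
      by (rule eq[of P h]) (use elim Pm P h in auto)
    moreover have "?I Q r = ((\<integral>y. indicator (cball 0 1) y * Q r (sgn y) ^ n \<partial>lborel) - r ^ n * (\<integral>y. indicator (cball 0 1) (y::'a) \<partial>lborel)) / r ^ (n - 1)"
      by (rule eq[of Q g]) (use elim Qm Q g in auto)
    ultimately have "0 < ((\<integral>y. indicator (cball 0 1) y * Q r (sgn y) ^ n \<partial>lborel) - (\<integral>y. indicator (cball 0 1) y * P r (sgn y) ^ n \<partial>lborel)) / r ^ (n - 1)"
      using elim(1) by (simp add: diff_divide_distrib)
    then show ?case using elim(2) by (simp add: zero_less_divide_iff)
  qed
qed


text \<open>All the balls contain the origin, so their union is star shaped and its radial function
  is the largest of theirs. For the intersection below it is the smallest.\<close>

lemma measure_UN_cball_eq: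
  fixes p :: "nat \<Rightarrow> 'a::euclidean_space"
  assumes N: "N \<ge> 1" and p: "\<And>k. k < N \<Longrightarrow> norm (p k) \<le> r"
  shows "measure lborel (\<Union>i<N. cball (p i) r) =
    (\<integral>y. indicator (cball 0 1) y * Max ((\<lambda>k. ball_radial (p k) r (sgn y)) ` {..<N}) ^ DIM('a) \<partial>lborel)"
proof -
  have ne: "{..<N} \<noteq> {}" using N by (auto simp: lessThan_empty_iff)
  show ?thesis
  proof (rule measure_star_shaped[where \<rho>="\<lambda>u. Max ((\<lambda>k. ball_radial (p k) r u) ` {..<N})"])
    show "(\<Union>i<N. cball (p i) r) \<in> sets borel" by (intro sets.finite_UN) auto
    show "0 \<le> Max ((\<lambda>k. ball_radial (p k) r u) ` {..<N})" for u
      using ne N by (subst Max_ge_iff) (auto intro!: bexI[of _ 0] ball_radial_nonneg p)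
    show "(\<lambda>u. Max ((\<lambda>k. ball_radial (p k) r u) ` {..<N})) \<in> borel_measurable borel"
      unfolding ball_radial_def by measurable
    show "t *\<^sub>R u \<in> (\<Union>i<N. cball (p i) r) \<longleftrightarrow> t \<le> Max ((\<lambda>k. ball_radial (p k) r u) ` {..<N})"
      if "norm u = 1" "t > 0" for u t
    proof -
      have "t *\<^sub>R u \<in> (\<Union>i<N. cball (p i) r) \<longleftrightarrow> (\<exists>i<N. t \<le> ball_radial (p i) r u)"
        using scaleR_in_cball_iff[OF that p] by auto
      also have "\<dots> \<longleftrightarrow> t \<le> Max ((\<lambda>k. ball_radial (p k) r u) ` {..<N})"
        using ne by (subst Max_ge_iff) auto
      finally show ?thesis .
    qed
  qed
qed

lemma measure_INT_cball_eq:
  fixes p :: "nat \<Rightarrow> 'a::euclidean_space"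
  assumes N: "N \<ge> 1" and p: "\<And>k. k < N \<Longrightarrow> norm (p k) \<le> r"
  shows "measure lborel (\<Inter>i<N. cball (p i) r) =
    (\<integral>y. indicator (cball 0 1) y * Min ((\<lambda>k. ball_radial (p k) r (sgn y)) ` {..<N}) ^ DIM('a) \<partial>lborel)"
proof -
  have ne: "{..<N} \<noteq> {}" using N by (auto simp: lessThan_empty_iff)
  show ?thesis
  proof (rule measure_star_shaped[where \<rho>="\<lambda>u. Min ((\<lambda>k. ball_radial (p k) r u) ` {..<N})"])
    show "(\<Inter>i<N. cball (p i) r) \<in> sets borel" using ne by (intro sets.finite_INT) auto
    show "0 \<le> Min ((\<lambda>k. ball_radial (p k) r u) ` {..<N})" for u
      using ne N by (subst Min_ge_iff) (auto intro!: ball_radial_nonneg p)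
    show "(\<lambda>u. Min ((\<lambda>k. ball_radial (p k) r u) ` {..<N})) \<in> borel_measurable borel"
      unfolding ball_radial_def by measurable
    show "t *\<^sub>R u \<in> (\<Inter>i<N. cball (p i) r) \<longleftrightarrow> t \<le> Min ((\<lambda>k. ball_radial (p k) r u) ` {..<N})"
      if "norm u = 1" "t > 0" for u t
    proof -
      have "t *\<^sub>R u \<in> (\<Inter>i<N. cball (p i) r) \<longleftrightarrow> (\<forall>i<N. t \<le> ball_radial (p i) r u)"
        using scaleR_in_cball_iff[OF that p] by auto
      also have "\<dots> \<longleftrightarrow> t \<le> Min ((\<lambda>k. ball_radial (p k) r u) ` {..<N})"
        using ne by (subst Min_ge_iff) auto
      finally show ?thesis .
    qed
  qed
qed

text \<open>A maximum moves by no more than its entries do, so the error for a single ball carries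
  over. The minimum is the negative of a maximum of negated entries, whence the support function at
  \<open>- u\<close>.\<close>

lemma Max_ball_radial_approx:
  assumes N: "N \<ge> 1" and p: "\<And>k. k < N \<Longrightarrow> norm (p k) \<le> R"
    and r: "r \<ge> R + 1" and u: "norm u \<le> 1"
  shows "\<bar>Max ((\<lambda>k. ball_radial (p k) r u) ` {..<N}) - (support N p u + r)\<bar> \<le> R\<^sup>2 / r"
    and "\<bar>Min ((\<lambda>k. ball_radial (p k) r u) ` {..<N}) - (- support N p (- u) + r)\<bar> \<le> R\<^sup>2 / r"
proof -
  have ne: "{..<N} \<noteq> {}" using N by (auto simp: lessThan_empty_iff)
  have "0 \<le> R" using order_trans[OF norm_ge_zero p[of 0]] N by simp
  then have r0: "r > 0" using r by simp
  have b: "\<bar>ball_radial (p k) r u - (p k \<bullet> u + r)\<bar> \<le> R\<^sup>2 / r" if "k < N" for k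
  proof -
    have "\<bar>ball_radial (p k) r u - (p k \<bullet> u + r)\<bar> \<le> (norm (p k))\<^sup>2 / r"
      using p[OF that] r u r0 by (intro ball_radial_approx) auto
    also have "\<dots> \<le> R\<^sup>2 / r" using p[OF that] r0 by (intro divide_right_mono power_mono) auto
    finally show ?thesis .
  qed
  have "support N p u + r = Max ((\<lambda>k. p k \<bullet> u + r) ` {..<N})"
    using ne by (simp add: support_def Max_add_commute)
  then show "\<bar>Max ((\<lambda>k. ball_radial (p k) r u) ` {..<N}) - (support N p u + r)\<bar> \<le> R\<^sup>2 / r"
    using ne b by (auto intro!: abs_Max_diff_le)
  have "support N p (- u) + (- r) = Max ((\<lambda>k. p k \<bullet> (- u) + (- r)) ` {..<N})"
    using ne Max_add_commute[of "{..<N}" "\<lambda>k. p k \<bullet> (- u)" "- r"] by (simp add: support_def)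
  moreover have "\<bar>Max ((\<lambda>k. - ball_radial (p k) r u) ` {..<N}) - Max ((\<lambda>k. p k \<bullet> (- u) + (- r)) ` {..<N})\<bar> \<le> R\<^sup>2 / r"
    using ne b by (intro abs_Max_diff_le) (force simp: abs_le_iff)+
  moreover have "Min ((\<lambda>k. ball_radial (p k) r u) ` {..<N}) = - Max ((\<lambda>k. - ball_radial (p k) r u) ` {..<N})"
    using ne by (intro Min_eq_minus_Max) auto
  ultimately show "\<bar>Min ((\<lambda>k. ball_radial (p k) r u) ` {..<N}) - (- support N p (- u) + r)\<bar> \<le> R\<^sup>2 / r"
    by linarith
qed

lemma integral_lborel_uminus:
  fixes f :: "'a::euclidean_space \<Rightarrow> real"
  assumes [measurable]: "f \<in> borel_measurable borel"
  shows "(\<integral>x. f (- x) \<partial>lborel) = integral\<^sup>L lborel f"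
  by (subst (2) lborel_affine[of "-1" 0]) (simp_all add: density_1 integral_distr)

text \<open>The same mean width inequality settles both claims. The support function enters the
  intersection with a minus sign, which reverses the order.\<close>

lemma eventually_cball_volume_less:
  fixes p q :: "nat \<Rightarrow> 'a::euclidean_space"
  assumes N: "N \<ge> 1"
    and le: "\<And>i j. i < N \<Longrightarrow> j < N \<Longrightarrow> norm (p i - p j) \<le> norm (q i - q j)"
    and strict: "i0 < N" "j0 < N" "norm (p i0 - p j0) < norm (q i0 - q j0)"
  shows "\<forall>\<^sub>F r in at_top. measure lborel (\<Union>i<N. cball (p i) r) < measure lborel (\<Union>i<N. cball (q i) r)"
    and "\<forall>\<^sub>F r in at_top. measure lborel (\<Inter>i<N. cball (q i) r) < measure lborel (\<Inter>i<N. cball (p i) r)"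
proof -
  define R where "R = (\<Sum>k<N. norm (p k)) + (\<Sum>k<N. norm (q k))"
  have Rp: "norm (p k) \<le> R" and Rq: "norm (q k) \<le> R" if "k < N" for k
  proof -
    have "norm (p k) \<le> (\<Sum>k<N. norm (p k))" "norm (q k) \<le> (\<Sum>k<N. norm (q k))"
      using that by (auto intro!: member_le_sum)
    moreover have "(\<Sum>k<N. norm (p k)) \<ge> 0" "(\<Sum>k<N. norm (q k)) \<ge> 0" by (simp_all add: sum_nonneg)
    ultimately show "norm (p k) \<le> R" "norm (q k) \<le> R" by (auto simp: R_def)
  qed
  have R0: "R \<ge> 0" unfolding R_def by (intro add_nonneg_nonneg sum_nonneg) auto
  define K where "K = R\<^sup>2 + R"
  have KR: "R\<^sup>2 / r \<le> K / r" if "r \<ge> R + 1" for r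
    using that R0 by (intro divide_right_mono) (auto simp: K_def)
  have sK: "\<bar>support N p' u\<bar> \<le> K" if "\<And>k. k < N \<Longrightarrow> norm (p' k) \<le> R" "norm u \<le> 1" for p' :: "nat \<Rightarrow> 'a" and u
  proof -
    have "\<bar>support N p' u\<bar> \<le> R * norm u" by (rule abs_support_le[OF N that(1)])
    also have "\<dots> \<le> R" using R0 that(2) by (simp add: mult_left_le)
    also have "\<dots> \<le> K" by (simp add: K_def)
    finally show ?thesis .
  qed
  have sm[measurable]: "support N p' \<in> borel_measurable borel" for p' :: "nat \<Rightarrow> 'a"
    by (intro borel_measurable_continuous_onI continuous_on_support N)
  have [measurable]: "cball 0 1 \<in> sets (borel :: 'a measure)" by simp
  have brM: "(\<lambda>u. Max ((\<lambda>k. ball_radial (p' k) r u) ` {..<N})) \<in> borel_measurable borel"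
    and brm: "(\<lambda>u. Min ((\<lambda>k. ball_radial (p' k) r u) ` {..<N})) \<in> borel_measurable borel"
    for p' :: "nat \<Rightarrow> 'a" and r
    unfolding ball_radial_def by measurable
  have less: "(\<integral>y. indicator (cball 0 1) y * support N p (sgn y) \<partial>lborel) <
    (\<integral>y. indicator (cball 0 1) y * support N q (sgn y) \<partial>lborel)"
    by (rule integral_support_strict_mono[OF N le strict])
  have "\<forall>\<^sub>F r in at_top.
      (\<integral>y. indicator (cball 0 1) y * Max ((\<lambda>k. ball_radial (p k) r (sgn y)) ` {..<N}) ^ DIM('a) \<partial>lborel) <
      (\<integral>y. indicator (cball 0 1) y * Max ((\<lambda>k. ball_radial (q k) r (sgn y)) ` {..<N}) ^ DIM('a) \<partial>lborel)"
  proof (rule eventually_integral_radial_power_less[where rmin="R + 1" and K=K, OF brM sm brM sm _ _ _ _ less])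
    show "\<bar>Max ((\<lambda>k. ball_radial (p k) r u) ` {..<N}) - (support N p u + r)\<bar> \<le> K / r"
      "\<bar>Max ((\<lambda>k. ball_radial (q k) r u) ` {..<N}) - (support N q u + r)\<bar> \<le> K / r"
      if "R + 1 \<le> r" "norm u \<le> 1" for r u
      using order_trans[OF Max_ball_radial_approx(1)[OF N _ that] KR[OF that(1)]] Rp Rq by auto
  qed (auto intro: sK Rp Rq)
  then show "\<forall>\<^sub>F r in at_top. measure lborel (\<Union>i<N. cball (p i) r) < measure lborel (\<Union>i<N. cball (q i) r)"
    using eventually_ge_at_top[of R]
  proof eventually_elim
    case (elim r)
    then show ?case
      using order_trans[OF Rp elim(2)] order_trans[OF Rq elim(2)] by (simp add: measure_UN_cball_eq[OF N])
  qed
  \<comment> \<open>The unit ball is symmetric under \<open>y \<mapsto> - y\<close>, so the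
    reflected support function has the same mean.\<close>
  have refl: "(\<integral>y. indicator (cball 0 1) y * (- support N p' (- sgn y)) \<partial>lborel) =
     - (\<integral>y. indicator (cball 0 1) y * support N p' (sgn y) \<partial>lborel)" for p' :: "nat \<Rightarrow> 'a"
  proof -
    have "(\<integral>y. indicator (cball 0 1) (- y) * support N p' (sgn (- y)) \<partial>lborel) =
      (\<integral>y. indicator (cball 0 1) y * support N p' (sgn y) \<partial>lborel)"
      by (rule integral_lborel_uminus) measurable
    moreover have "indicator (cball 0 1) (- y) = (indicator (cball 0 1) y :: real)" for y :: 'a
      by (simp add: indicator_def)
    ultimately show ?thesis by (simp add: sgn_minus)
  qed
  have "\<forall>\<^sub>F r in at_top.
      (\<integral>y. indicator (cball 0 1) y * Min ((\<lambda>k. ball_radial (q k) r (sgn y)) ` {..<N}) ^ DIM('a) \<partial>lborel) <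
      (\<integral>y. indicator (cball 0 1) y * Min ((\<lambda>k. ball_radial (p k) r (sgn y)) ` {..<N}) ^ DIM('a) \<partial>lborel)"
  proof (rule eventually_integral_radial_power_less[where rmin="R + 1" and K=K and
        h="\<lambda>u. - support N q (- u)" and g="\<lambda>u. - support N p (- u)", OF brm _ brm])
    show "\<bar>Min ((\<lambda>k. ball_radial (q k) r u) ` {..<N}) - (- support N q (- u) + r)\<bar> \<le> K / r"
      "\<bar>Min ((\<lambda>k. ball_radial (p k) r u) ` {..<N}) - (- support N p (- u) + r)\<bar> \<le> K / r"
      if "R + 1 \<le> r" "norm u \<le> 1" for r u
      using order_trans[OF Max_ball_radial_approx(2)[OF N _ that] KR[OF that(1)]] Rp Rq by auto
    show "(\<integral>y. indicator (cball 0 1) y * - support N q (- sgn y) \<partial>lborel) <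
      (\<integral>y. indicator (cball 0 1) y * - support N p (- sgn y) \<partial>lborel)"
      using less unfolding refl by simp
    show "(\<lambda>u. - support N q (- u)) \<in> borel_measurable borel" "(\<lambda>u. - support N p (- u)) \<in> borel_measurable borel"
      by measurable
    show "\<bar>- support N q (- u)\<bar> \<le> K" "\<bar>- support N p (- u)\<bar> \<le> K" if "norm u \<le> 1" for u
      using sK[of q "- u"] sK[of p "- u"] Rp Rq that by auto
  qed simp
  then show "\<forall>\<^sub>F r in at_top. measure lborel (\<Inter>i<N. cball (q i) r) < measure lborel (\<Inter>i<N. cball (p i) r)"
    using eventually_ge_at_top[of R]
  proof eventually_elim
    case (elim r)
    then show ?case
      using order_trans[OF Rp elim(2)] order_trans[OF Rq elim(2)] by (simp add: measure_INT_cball_eq[OF N])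
  qed
qed

subsection \<open>Isometries\<close>

text \<open>The map is the reflection in the perpendicular bisector of \<open>a\<close> and
  \<open>b\<close>, which consists of the points equidistant from both.\<close>

lemma reflection_isometry:
  fixes a b :: "'a::real_inner"
  assumes "a \<noteq> b"
  obtains f where "\<And>x y. dist (f x) (f y) = dist x y" "f a = b" "\<And>x. dist x a = dist x b \<Longrightarrow> f x = x"
proof -
  define n where "n = a - b"
  define f where "f = (\<lambda>x. x - (((2 *\<^sub>R x - (a + b)) \<bullet> n) / (n \<bullet> n)) *\<^sub>R n)"
  have n: "n \<bullet> n \<noteq> 0" using assms by (simp add: n_def)
  have 1: "f a = b"
  proof -
    have "(2 *\<^sub>R a - (a + b)) = n" by (simp add: n_def scaleR_2)
    then show ?thesis using n by (simp add: f_def) (simp add: n_def)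
  qed
  have 2: "f x = x" if "dist x a = dist x b" for x
  proof -
    have "(x - a) \<bullet> (x - a) = (x - b) \<bullet> (x - b)"
      using that by (simp add: dist_norm norm_eq)
    then have "(2 *\<^sub>R x - (a + b)) \<bullet> n = 0"
      by (simp add: n_def inner_diff_left inner_diff_right inner_add_left inner_commute algebra_simps)
    then show ?thesis by (simp add: f_def)
  qed
  have 3: "dist (f x) (f y) = dist x y" for x y
  proof -
    define d where "d = x - y"
    define c where "c = 2 * (d \<bullet> n) / (n \<bullet> n)"
    have "f x - f y = d - c *\<^sub>R n"
      unfolding f_def d_def c_def
      by (simp add: inner_diff_left diff_divide_distrib algebra_simps)
    moreover have "(d - c *\<^sub>R n) \<bullet> (d - c *\<^sub>R n) = d \<bullet> d"
    proof -
      have "(d - c *\<^sub>R n) \<bullet> (d - c *\<^sub>R n) = d \<bullet> d - 2 * c * (d \<bullet> n) + c * (c * (n \<bullet> n))"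
        by (simp add: inner_diff_left inner_diff_right inner_commute algebra_simps)
      also have "c * (n \<bullet> n) = 2 * (d \<bullet> n)" using n by (simp add: c_def)
      finally show ?thesis by simp
    qed
    ultimately show ?thesis by (simp add: dist_norm d_def norm_eq)
  qed
  from 3 1 2 show ?thesis by (rule that)
qed

text \<open>Points are matched one at a time by composing with a reflection that moves the current
  image of \<open>p N\<close> to \<open>q N\<close>. The earlier \<open>q i\<close> are equidistant
  from both points and stay fixed.\<close>

lemma isometry_extension:
  fixes p q :: "nat \<Rightarrow> 'a::real_inner"
  assumes "\<And>i j. i < N \<Longrightarrow> j < N \<Longrightarrow> dist (p i) (p j) = dist (q i) (q j)"
  shows "\<exists>f. (\<forall>x y. dist (f x) (f y) = dist x y) \<and> (\<forall>i<N. f (p i) = q i)"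
  using assms
proof (induction N)
  case 0
  show ?case by (rule exI[of _ id]) simp
next
  case (Suc N)
  then obtain f where f: "\<And>x y. dist (f x) (f y) = dist x y" "\<And>i. i < N \<Longrightarrow> f (p i) = q i" by auto
  show ?case
  proof (cases "f (p N) = q N")
    case True
    then show ?thesis using f by (intro exI[of _ f]) (auto simp: less_Suc_eq)
  next
    case False
    then obtain g where g: "\<And>x y. dist (g x) (g y) = dist x y" "g (f (p N)) = q N"
      "\<And>x. dist x (f (p N)) = dist x (q N) \<Longrightarrow> g x = x"
      using reflection_isometry[OF False] by metis
    have "g (f (p i)) = q i" if "i < N" for i
    proof -
      have "dist (q i) (f (p N)) = dist (f (p i)) (f (p N))" using f(2)[OF that] by simp
      also have "\<dots> = dist (q i) (q N)" using f(1) Suc.prems[of i N] that by simp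
      finally show ?thesis using g(3) f(2)[OF that] by simp
    qed
    then show ?thesis using f g by (intro exI[of _ "g \<circ> f"]) (auto simp: less_Suc_eq)
  qed
qed

text \<open>Both sides, multiplied by the volume of the rotation invariant unit ball, are the integral of
  \<open>indicator (ball 0 1) y * indicator A (g x + y)\<close> over all \<open>x\<close> and \<open>y\<close>.\<close>

lemma emeasure_vimage_orthogonal_transformation:
  fixes g :: "'a::euclidean_space \<Rightarrow> 'a"
  assumes g: "orthogonal_transformation g" and [measurable]: "A \<in> sets borel"
  shows "emeasure lborel (g -` A) = emeasure lborel A"
proof -
  have lin: "linear g" using g by (rule orthogonal_transformation_linear)
  have [measurable]: "g \<in> borel_measurable borel"
    by (intro borel_measurable_continuous_onI linear_continuous_on linear_conv_bounded_linear[THEN iffD1] lin)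
  have surj: "\<exists>w. g w = y" for y using orthogonal_transformation_surj[OF g] by (metis surjD)
  have trans: "(\<integral>\<^sup>+x. f (x + c) \<partial>lborel) = (\<integral>\<^sup>+x. f x \<partial>lborel)" if [measurable]: "f \<in> borel_measurable borel" for f :: "'a \<Rightarrow> ennreal" and c
    by (subst (2) lborel_distr_plus[of c, symmetric]) (simp add: nn_integral_distr add.commute)
  have [measurable]: "ball 0 1 \<in> sets (borel :: 'a measure)" by simp
  let ?b = "emeasure lborel (ball (0::'a) 1)"
  have gA: "g -` A \<in> sets lborel" using measurable_sets[of g borel borel A] by simp
  have "emeasure lborel (g -` A) * ?b = (\<integral>\<^sup>+y. emeasure lborel (g -` A) * indicator (ball (0::'a) 1) y \<partial>lborel)"
    by (simp add: nn_integral_cmult)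
  also have "\<dots> = (\<integral>\<^sup>+y. (\<integral>\<^sup>+x. indicator A (g x + y) * indicator (ball (0::'a) 1) y \<partial>lborel) \<partial>lborel)"
  proof (rule nn_integral_cong)
    fix y :: 'a
    \<comment> \<open>Writing \<open>y\<close> as \<open>g w\<close> turns the shift by
      \<open>y\<close> after applying \<open>g\<close> into a translation of \<open>x\<close> by
      \<open>w\<close>, which does not change the integral.\<close>
    obtain w where w: "g w = y" using surj by blast
    have "emeasure lborel (g -` A) = (\<integral>\<^sup>+x. indicator A (g x) \<partial>lborel)"
      using nn_integral_indicator[OF gA] by (simp add: indicator_def vimage_def)
    also have "\<dots> = (\<integral>\<^sup>+x. indicator A (g (x + w)) \<partial>lborel)"
      by (rule trans[symmetric]) measurable
    finally have "emeasure lborel (g -` A) = (\<integral>\<^sup>+x. indicator A (g x + y) \<partial>lborel)"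
      by (simp add: linear_add[OF lin] w)
    then show "emeasure lborel (g -` A) * indicator (ball 0 1) y =
        (\<integral>\<^sup>+x. indicator A (g x + y) * indicator (ball (0::'a) 1) y \<partial>lborel)"
      by (simp add: nn_integral_multc)
  qed
  also have "\<dots> = (\<integral>\<^sup>+x. (\<integral>\<^sup>+y. indicator A (g x + y) * indicator (ball (0::'a) 1) y \<partial>lborel) \<partial>lborel)"
    by (rule lborel_pair.Fubini') measurable
  also have "\<dots> = (\<integral>\<^sup>+x. (\<integral>\<^sup>+y. indicator A y * indicator (ball (0::'a) 1) (y - g x) \<partial>lborel) \<partial>lborel)"
  proof (rule nn_integral_cong)
    fix x
    have "(\<integral>\<^sup>+y. indicator A (y + g x) * indicator (ball (0::'a) 1) (y + g x - g x) \<partial>lborel) =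
      (\<integral>\<^sup>+y. indicator A y * indicator (ball (0::'a) 1) (y - g x) \<partial>lborel)"
      by (rule trans) measurable
    then show "(\<integral>\<^sup>+y. indicator A (g x + y) * indicator (ball (0::'a) 1) y \<partial>lborel) =
      (\<integral>\<^sup>+y. indicator A y * indicator (ball (0::'a) 1) (y - g x) \<partial>lborel)" by (simp add: add.commute)
  qed
  also have "\<dots> = (\<integral>\<^sup>+y. (\<integral>\<^sup>+x. indicator A y * indicator (ball (0::'a) 1) (y - g x) \<partial>lborel) \<partial>lborel)"
    by (rule lborel_pair.Fubini') measurable
  also have "\<dots> = (\<integral>\<^sup>+y. indicator A y * ?b \<partial>lborel)"
  proof (rule nn_integral_cong)
    fix y :: 'a
    obtain w where w: "g w = y" using surj by blast
    have "(\<integral>\<^sup>+x. indicator (ball (0::'a) 1) (y - g x) \<partial>lborel) = (\<integral>\<^sup>+x. indicator (ball 0 1) (x + (- w)) \<partial>lborel)"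
    proof (rule nn_integral_cong)
      fix x
      \<comment> \<open>The rotation invariance of the ball enters here.\<close>
      have "norm (y - g x) = norm (w - x)"
        using orthogonal_transformation_norm[OF g, of "w - x"] by (simp add: linear_diff[OF lin] w)
      then show "indicator (ball (0::'a) 1) (y - g x) = (indicator (ball 0 1) (x + (- w)) :: ennreal)"
        by (simp add: indicator_def norm_minus_commute)
    qed
    also have "\<dots> = (\<integral>\<^sup>+x. indicator (ball (0::'a) 1) x \<partial>lborel)" by (rule trans) measurable
    finally show "(\<integral>\<^sup>+x. indicator A y * indicator (ball (0::'a) 1) (y - g x) \<partial>lborel) = indicator A y * ?b"
      by (simp add: nn_integral_cmult)
  qed
  also have "\<dots> = emeasure lborel A * ?b" by (simp add: nn_integral_multc)
  finally have "emeasure lborel (g -` A) * ?b = emeasure lborel A * ?b" .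
  moreover have "?b \<noteq> 0" "?b \<noteq> top"
    using content_ball_pos[of 1 "0::'a"] emeasure_lborel_ball_finite[of "0::'a" 1]
    by (auto simp: measure_def)
  ultimately show ?thesis by (metis mult_divide_eq_ennreal)
qed

text \<open>An isometry is an orthogonal map followed by the translation by \<open>f 0\<close>, and
  both preserve volume.\<close>

lemma measure_vimage_isometry:
  fixes f :: "'a::euclidean_space \<Rightarrow> 'a"
  assumes f: "\<And>x y. dist (f x) (f y) = dist x y" and A: "A \<in> sets borel"
  shows "measure lborel (f -` A) = measure lborel A"
proof -
  define g where "g = (\<lambda>x. f x - f 0)"
  have g: "orthogonal_transformation g"
    unfolding orthogonal_transformation_isometry using f by (simp add: g_def dist_norm)
  have A': "(\<lambda>x. f 0 + x) -` A \<in> sets borel"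
    using measurable_sets[of "\<lambda>x. f 0 + x" borel borel A] A by simp
  have "f -` A = g -` ((\<lambda>x. f 0 + x) -` A)" by (auto simp: g_def)
  then have "emeasure lborel (f -` A) = emeasure lborel ((\<lambda>x. f 0 + x) -` A)"
    using emeasure_vimage_orthogonal_transformation[OF g A'] by simp
  also have "\<dots> = emeasure (distr lborel borel ((+) (f 0))) A" using A by (simp add: emeasure_distr)
  finally show ?thesis by (simp add: lborel_distr_plus measure_def)
qed

theorem theorem1:
  fixes p q :: "nat \<Rightarrow> real ^ 'n" and N :: nat
  assumes "N \<ge> 1"
    and "\<And>i j. i < N \<Longrightarrow> j < N \<Longrightarrow> i < j \<Longrightarrow> norm (p i - p j) \<le> norm (q i - q j)"
  shows "\<exists>r0 > 0.
     (\<forall>r \<ge> r0.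
        measure lebesgue (\<Union>i<N. cball (p i) r) \<le> measure lebesgue (\<Union>i<N. cball (q i) r) \<and>
        measure lebesgue (\<Inter>i<N. cball (p i) r) \<ge> measure lebesgue (\<Inter>i<N. cball (q i) r)) \<and>
     (\<not> congruent_config N p q \<longrightarrow>
        (\<forall>r \<ge> r0.
           measure lebesgue (\<Union>i<N. cball (p i) r) < measure lebesgue (\<Union>i<N. cball (q i) r) \<and>
           measure lebesgue (\<Inter>i<N. cball (p i) r) > measure lebesgue (\<Inter>i<N. cball (q i) r)))"
proof -
  have le: "norm (p i - p j) \<le> norm (q i - q j)" if "i < N" "j < N" for i j
    using assms(2)[of i j] assms(2)[of j i] that by (cases i j rule: linorder_cases) (auto simp: norm_minus_commute)
  have leb: "measure lebesgue (\<Union>i<N. cball (f i) r) = measure lborel (\<Union>i<N. cball (f i) r)"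
    "measure lebesgue (\<Inter>i<N. cball (f i) r) = measure lborel (\<Inter>i<N. cball (f i) r)"
    for f :: "nat \<Rightarrow> real ^ 'n" and r
  proof -
    have "(\<Union>i<N. cball (f i) r) \<in> sets borel" by (intro sets.finite_UN) auto
    moreover have "(\<Inter>i<N. cball (f i) r) \<in> sets borel"
      using assms(1) by (intro sets.finite_INT) (auto simp: lessThan_empty_iff)
    ultimately show "measure lebesgue (\<Union>i<N. cball (f i) r) = measure lborel (\<Union>i<N. cball (f i) r)"
      "measure lebesgue (\<Inter>i<N. cball (f i) r) = measure lborel (\<Inter>i<N. cball (f i) r)"
      by (simp_all add: measure_completion)
  qed
  show ?thesis
  \<comment> \<open>If some distance grows, both inequalities are strict for large \<open>r\<close>,
    which also covers the weak ones. If none does, the configurations are congruent and the volumes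
    agree for every radius.\<close>
  proof (cases "\<exists>i<N. \<exists>j<N. norm (p i - p j) < norm (q i - q j)")
    case True
    then obtain i0 j0 where "i0 < N" "j0 < N" "norm (p i0 - p j0) < norm (q i0 - q j0)" by blast
    from eventually_conj[OF eventually_cball_volume_less[OF assms(1) le this]]
    obtain r0 where r0: "\<And>r. r \<ge> r0 \<Longrightarrow>
       measure lborel (\<Union>i<N. cball (p i) r) < measure lborel (\<Union>i<N. cball (q i) r) \<and>
       measure lborel (\<Inter>i<N. cball (q i) r) < measure lborel (\<Inter>i<N. cball (p i) r)"
      by (auto simp: eventually_at_top_linorder)
    show ?thesis unfolding leb
      \<comment> \<open>The 1 guarantees a positive threshold, since the filter gives an
        \<open>r0\<close> of unknown sign.\<close>
      by (rule exI[of _ "max 1 r0"]) (use r0 in \<open>auto intro: less_imp_le\<close>)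
  next
    case False
    have "dist (p i) (p j) = dist (q i) (q j)" if "i < N" "j < N" for i j
    proof -
      have "\<not> norm (p i - p j) < norm (q i - q j)" using False that by blast
      with le[OF that] show ?thesis by (simp add: dist_norm)
    qed
    from isometry_extension[of N p q, OF this] obtain f where
      f: "\<And>x y. dist (f x) (f y) = dist x y" "\<And>i. i < N \<Longrightarrow> f (p i) = q i" by blast
    then have "congruent_config N p q" unfolding congruent_config_def by blast
    \<comment> \<open>Preimages commute with unions and intersections alike, so pulling the balls
      back along \<open>f\<close> treats both volumes at once.\<close>
    moreover have "cball (p i) r = f -` cball (q i) r" if "i < N" for i r
      using f(1)[of "p i"] f(2)[OF that] by (auto simp: vimage_def)
    then have "(\<Union>i<N. cball (p i) r) = f -` (\<Union>i<N. cball (q i) r)"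
      "(\<Inter>i<N. cball (p i) r) = f -` (\<Inter>i<N. cball (q i) r)" for r
      by (auto simp: vimage_UN vimage_INT)
    moreover have "(\<Union>i<N. cball (q i) r) \<in> sets borel" "(\<Inter>i<N. cball (q i) r) \<in> sets borel" for r
      using assms(1) by (auto intro!: sets.finite_UN sets.finite_INT simp: lessThan_empty_iff)
    ultimately show ?thesis
      unfolding leb by (intro exI[of _ 1]) (simp add: measure_vimage_isometry[OF f(1)])
  qed
qed

end
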